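(* Let $y\in\mathcal{I}_{\mathbb{Z}}$ and $w\in\mathcal{A}(y)$. Suppose $i<j$ in $\mathbb{Z}$ are such that $w\lessdot w(i,j)$. (a) If $w(i,j)\in\mathcal{A}(z)$ for some $z\in\mathcal{I}_{\mathbb{Z}}$, then $z=\tau_{ij}(y)\neq y$. (b) If $w(i,j)\notin\mathcal{A}(z)$ for all $z\in\mathcal{I}_{\mathbb{Z}}$, then $\tau_{ij}(y)=y$.
   Context: $S_{\mathbb{Z}}$ is the group of permutations of $\mathbb{Z}$ fixing all but finitely many integers; products are compositions of functions (so $w(i,j)$ is the product of $w$ with the transposition $(i,j)$ on the right); $s_i=(i,i+1)$. $\ell(w)$ is the number of pairs $i<j$ with $w(i)>w(j)$. The Bruhat order $<$ on $S_{\mathbb{Z}}$ is the weakest strict partial order with $w<wt$ whenever $t$ is a transposition with $\ell(w)<\ell(wt)$; $u\lessdot v$ means $\{u\}=\{\sigma\in S_{\mathbb{Z}}:u\le\sigma<v\}$. $\mathcal{I}_{\mathbb{Z}}=\{y\in S_{\mathbb{Z}}:y=y^{-1}\}$. The Demazure product is the unique associative map $\circ:S_{\mathbb{Z}}\times S_{\mathbb{Z}}\to S_{\mathbb{Z}}$ with $u\circ v=uv$ if $\ell(uv)=\ell(u)+\ell(v)$ and $s_i\circ s_i=s_i$ for all $i$. For $y\in\mathcal{I}_{\mathbb{Z}}$, $\mathcal{A}(y)$ is the set of $w\in S_{\mathbb{Z}}$ of minimal length with $y=w^{-1}\circ w$. The maps $\tau_{ij}$: for $y\in\mathcal{I}_{\mathbb{Z}}$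 and $i<j$ let $A=\{i,j,y(i),y(j)\}$. Then $\tau_{ij}(y)$ is the involution $z$ that agrees with $y$ on $\mathbb{Z}\setminus A$ and whose restriction to the $y$-invariant set $A$ is as follows (restrictions are written by their 2-cycles; unlisted elements of $A$ are fixed). (1) $A=\{a<b\}$, $y|_A=1$, $(i,j)=(a,b)$: $z|_A=(a,b)$. (2) $A=\{a<b<c\}$, $y|_A=(a,b)$, $(i,j)\in\{(b,c),(a,c)\}$: $z|_A=(a,c)$. (3) $A=\{a<b<c\}$, $y|_A=(b,c)$, $(i,j)\in\{(a,b),(a,c)\}$: $z|_A=(a,c)$. (4) $A=\{a<b<c<d\}$, $y|_A=(a,b)(c,d)$, $(i,j)=(b,c)$: $z|_A=(a,c)(b,d)$. (5) $A=\{a<b<c<d\}$, $y|_A=(a,b)(c,d)$, $(i,j)\in\{(a,c),(b,d),(a,d)\}$: $z|_A=(a,d)$. (6) $A=\{a<b<c<d\}$, $y|_A=(a,c)(b,d)$, $(i,j)\in\{(a,b),(c,d),(a,d)\}$: $z|_A=(a,d)(b,c)$. In all other cases $\tau_{ij}(y)=y$. *)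

theory Defs
  imports "HOL-Combinatorics.Perm"
begin

unbundle permutation_syntax

text \<open>
  The library type \<open>'a perm\<close> consists of the bijections of \<open>'a\<close> moving only finitely many points,
  with composition as multiplication, so the group \<open>S_Z\<close> is the type \<open>int perm\<close>.
\<close>

definition inv_count :: "int perm \<Rightarrow> nat" where
  "inv_count w = card {(i, j). i < j \<and> w \<langle>$\<rangle> i > w \<langle>$\<rangle> j}"

definition simple_refl :: "int \<Rightarrow> int perm" where
  "simple_refl i = \<langle>i \<leftrightarrow> i + 1\<rangle>"

definition is_transposition :: "int perm \<Rightarrow> bool" where
  "is_transposition t \<longleftrightarrow> (\<exists>a b. a \<noteq> b \<and> t = \<langle>a \<leftrightarrow> b\<rangle>)"


definition bruhat_compatible :: "(int perm \<Rightarrow> int perm \<Rightarrow> bool) \<Rightarrow> bool" where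
  "bruhat_compatible R \<longleftrightarrow> irreflp R \<and> transp R \<and>
     (\<forall>w t. is_transposition t \<longrightarrow> inv_count w < inv_count (w * t) \<longrightarrow> R w (w * t))"

text \<open>
  The weakest compatible strict partial order is the intersection of all of them; this is again
  one of them, as \<open>inv_count u < inv_count v\<close> is compatible, so the family is not empty.
\<close>

definition bruhat_less :: "int perm \<Rightarrow> int perm \<Rightarrow> bool" where
  "bruhat_less u v \<longleftrightarrow> (\<forall>R. bruhat_compatible R \<longrightarrow> R u v)"

definition bruhat_le :: "int perm \<Rightarrow> int perm \<Rightarrow> bool" where
  "bruhat_le u v \<longleftrightarrow> u = v \<or> bruhat_less u v"

definition bruhat_covers :: "int perm \<Rightarrow> int perm \<Rightarrow> bool" where
  "bruhat_covers u v \<longleftrightarrow> {u} = {\<sigma>. bruhat_le u \<sigma> \<and> bruhat_less \<sigma> v}"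

lemma bruhat_compatible_inv_count:
  "bruhat_compatible (\<lambda>u v. inv_count u < inv_count v)"
  by (auto simp: bruhat_compatible_def irreflp_def transp_def)

lemma bruhat_less_least:
  "bruhat_compatible R \<Longrightarrow> bruhat_less u v \<Longrightarrow> R u v"
  unfolding bruhat_less_def by (drule spec, erule mp)

lemma bruhat_compatible_bruhat_less:
  "bruhat_compatible bruhat_less"
  unfolding bruhat_compatible_def
proof (intro conjI allI impI)
  show "irreflp bruhat_less"
  proof (rule irreflpI)
    fix u
    show "\<not> bruhat_less u u"
      using bruhat_less_least [OF bruhat_compatible_inv_count, of u u] by auto
  qed
  show "transp bruhat_less"
  proof (rule transpI)
    fix u v w
    assume uv: "bruhat_less u v" and vw: "bruhat_less v w"
    show "bruhat_less u w"
      unfolding bruhat_less_def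
    proof (intro allI impI)
      fix R assume R: "bruhat_compatible R"
      then have "transp R" by (simp add: bruhat_compatible_def)
      then show "R u w"
        by (rule transpD) (rule bruhat_less_least [OF R uv], rule bruhat_less_least [OF R vw])
    qed
  qed
  show "bruhat_less w (w * t)"
    if "is_transposition t" "inv_count w < inv_count (w * t)" for w t
    unfolding bruhat_less_def
  proof (intro allI impI)
    fix R assume "bruhat_compatible R"
    then show "R w (w * t)" using that by (simp add: bruhat_compatible_def)
  qed
qed


definition is_demazure :: "(int perm \<Rightarrow> int perm \<Rightarrow> int perm) \<Rightarrow> bool" where
  "is_demazure d \<longleftrightarrow>
     (\<forall>u v w. d (d u v) w = d u (d v w)) \<and>
     (\<forall>u v. inv_count (u * v) = inv_count u + inv_count v \<longrightarrow> d u v = u * v) \<and>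
     (\<forall>i. d (simple_refl i) (simple_refl i) = simple_refl i)"

definition demazure :: "int perm \<Rightarrow> int perm \<Rightarrow> int perm" where
  "demazure = (THE d. is_demazure d)"

definition involutions :: "int perm set" where
  "involutions = {y. y = inverse y}"

definition atoms :: "int perm \<Rightarrow> int perm set" where
  "atoms y = {w. is_arg_min inv_count (\<lambda>v. y = demazure (inverse v) v) w}"


definition agree_on :: "int set \<Rightarrow> int perm \<Rightarrow> int perm \<Rightarrow> bool" where
  "agree_on A u v \<longleftrightarrow> (\<forall>x\<in>A. u \<langle>$\<rangle> x = v \<langle>$\<rangle> x)"

text \<open>
  \<open>tau_rule A y i j p\<close>: the triple given by \<open>A\<close>, the restriction of \<open>y\<close> to \<open>A\<close>, and \<open>(i, j)\<close> falls
  under one of the non-trivial cases in the definition of \<open>\<tau>\<close>, and \<open>p\<close> is the prescribed restriction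
  to \<open>A\<close> of the new involution, extended by the identity outside \<open>A\<close>.
\<close>

inductive tau_rule :: "int set \<Rightarrow> int perm \<Rightarrow> int \<Rightarrow> int \<Rightarrow> int perm \<Rightarrow> bool"
  for A :: "int set" and y :: "int perm" and i j :: int where
  case1: "\<lbrakk>A = {a, b}; a < b; agree_on A y 1; (i, j) = (a, b)\<rbrakk>
    \<Longrightarrow> tau_rule A y i j \<langle>a \<leftrightarrow> b\<rangle>"
| case2: "\<lbrakk>A = {a, b, c}; a < b; b < c; agree_on A y \<langle>a \<leftrightarrow> b\<rangle>; (i, j) \<in> {(b, c), (a, c)}\<rbrakk>
    \<Longrightarrow> tau_rule A y i j \<langle>a \<leftrightarrow> c\<rangle>"
| case3: "\<lbrakk>A = {a, b, c}; a < b; b < c; agree_on A y \<langle>b \<leftrightarrow> c\<rangle>; (i, j) \<in> {(a, b), (a, c)}\<rbrakk>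
    \<Longrightarrow> tau_rule A y i j \<langle>a \<leftrightarrow> c\<rangle>"
| case4: "\<lbrakk>A = {a, b, c, d}; a < b; b < c; c < d; agree_on A y (\<langle>a \<leftrightarrow> b\<rangle> * \<langle>c \<leftrightarrow> d\<rangle>);
      (i, j) = (b, c)\<rbrakk>
    \<Longrightarrow> tau_rule A y i j (\<langle>a \<leftrightarrow> c\<rangle> * \<langle>b \<leftrightarrow> d\<rangle>)"
| case5: "\<lbrakk>A = {a, b, c, d}; a < b; b < c; c < d; agree_on A y (\<langle>a \<leftrightarrow> b\<rangle> * \<langle>c \<leftrightarrow> d\<rangle>);
      (i, j) \<in> {(a, c), (b, d), (a, d)}\<rbrakk>
    \<Longrightarrow> tau_rule A y i j \<langle>a \<leftrightarrow> d\<rangle>"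
| case6: "\<lbrakk>A = {a, b, c, d}; a < b; b < c; c < d; agree_on A y (\<langle>a \<leftrightarrow> c\<rangle> * \<langle>b \<leftrightarrow> d\<rangle>);
      (i, j) \<in> {(a, b), (c, d), (a, d)}\<rbrakk>
    \<Longrightarrow> tau_rule A y i j (\<langle>a \<leftrightarrow> d\<rangle> * \<langle>b \<leftrightarrow> c\<rangle>)"

definition tau_rel :: "int \<Rightarrow> int \<Rightarrow> int perm \<Rightarrow> int perm \<Rightarrow> bool" where
  "tau_rel i j y z \<longleftrightarrow>
     (let A = {i, j, y \<langle>$\<rangle> i, y \<langle>$\<rangle> j}
      in agree_on (- A) z y \<and> (\<exists>p. tau_rule A y i j p \<and> agree_on A z p))"

definition tau :: "int \<Rightarrow> int \<Rightarrow> int perm \<Rightarrow> int perm" where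
  "tau i j y = (if \<exists>z. tau_rel i j y z then THE z. tau_rel i j y z else y)"

end

theory Submission
  imports Defs
begin

text \<open>
  Let \<open>y\<close> be the involution with \<open>w \<in> atoms y\<close>. If \<open>k\<close> is an ascent of \<open>w\<close>, then passing from \<open>w\<close> to
  \<open>w s\<^sub>k\<close> replaces \<open>w\<inverse> \<circ> w\<close> by \<open>s\<^sub>k \<circ> (w\<inverse> \<circ> w) \<circ> s\<^sub>k\<close> (Demazure products). The number
  \<open>2 \<ell>(y) + |{x. y x \<noteq> x}|\<close> grows by exactly 4 whenever such a step changes \<open>y\<close>, so \<open>w\<close> is an atom iff
  all steps along a reduced word of \<open>w\<close> are strict (\<open>atoms_ascent_iff\<close>). An induction over these
  steps gives the description of atoms by Can, Joyce and Wyser (\<open>atoms_iff_pattern\<close>): \<open>w\<close> is an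
  atom of \<open>y\<close> iff for any two cycles of \<open>y\<close> the values of \<open>w\<close> on these at most four points are in one
  of a few admissible relative orders.

  The cover \<open>w \<lessdot> w (i, j)\<close> says that \<open>w i < w j\<close> and that no \<open>e\<close> between \<open>i\<close> and \<open>j\<close> has its value
  between \<open>w i\<close> and \<open>w j\<close>. Hence in each of the six cases of \<open>\<tau>\<^sub>i\<^sub>j\<close> it is a finite check, involving
  the cycles through \<open>i\<close> and \<open>j\<close> and one further cycle at a time, that \<open>w (i, j)\<close> satisfies the
  conditions for \<open>\<tau>\<^sub>i\<^sub>j y\<close> (\<open>swap_cover_tau_atoms\<close>).

  The six cases fail for a cover only if one of the two cycles of \<open>y\<close> through \<open>i\<close> and \<open>j\<close> is nested
  inside the other one (\<open>tau_rel_or_nested\<close>), and then \<open>w (i, j)\<close> is not an atom at all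
  (\<open>nested_not_atom\<close>). The reason is a descent: nestedness forces a common descent \<open>k\<close> of \<open>w\<close> and
  \<open>w (i, j)\<close>. Cancelling \<open>s\<^sub>k\<close> from both leaves a shorter cover. If the cycles remain nested, induction
  applies. If they do not, then \<open>\<tau>\<close> has already sent the smaller involution to one with descent \<open>k\<close>, so
  that the last step from it to \<open>w (i, j)\<close> is not strict.

  As \<open>w (i, j)\<close> is an atom of at most one involution, both parts of the theorem follow: \<open>w (i, j)\<close> is
  an atom iff one of the six cases applies, and then it is an atom of \<open>\<tau>\<^sub>i\<^sub>j y\<close>.
\<close>

section \<open>Length, ascents and transpositions\<close>

abbreviation ascent :: "int perm \<Rightarrow> int \<Rightarrow> bool" where
  "ascent w k \<equiv> w \<langle>$\<rangle> k < w \<langle>$\<rangle> (k + 1)"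

lemma apply_swap_if: "\<langle>a \<leftrightarrow> b\<rangle> \<langle>$\<rangle> x = (if x = a then b else if x = b then a else x)"
  by auto

lemma apply_simple_refl:
  "simple_refl k \<langle>$\<rangle> x = (if x = k then k + 1 else if x = k + 1 then k else x)"
  by (auto simp: simple_refl_def)

lemma apply_mult_simple_refl:
  "(w * simple_refl k) \<langle>$\<rangle> x = w \<langle>$\<rangle> (if x = k then k + 1 else if x = k + 1 then k else x)"
  by (simp add: apply_times apply_simple_refl)

lemma apply_mult_swap:
  "(w * \<langle>a \<leftrightarrow> b\<rangle>) \<langle>$\<rangle> x = w \<langle>$\<rangle> (if x = a then b else if x = b then a else x)"
  by (auto simp: apply_times)

lemma simple_refl_square [simp]: "simple_refl k * simple_refl k = 1"
  by (simp add: simple_refl_def)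

lemma mult_simple_refl_twice [simp]: "w * simple_refl k * simple_refl k = w"
  by (simp add: mult.assoc)

lemma inverse_simple_refl [simp]: "inverse (simple_refl k) = simple_refl k"
  by (simp add: simple_refl_def)

lemma ascent_cases: "ascent w k \<or> ascent (w * simple_refl k) k"
  using apply_inj[of w k "k + 1"] by (auto simp: apply_mult_simple_refl)

lemma ascent_mult_simple_refl: "ascent (w * simple_refl k) k \<longleftrightarrow> \<not> ascent w k"
  using apply_inj[of w k "k + 1"] by (auto simp: apply_mult_simple_refl)

definition inversions :: "int perm \<Rightarrow> (int \<times> int) set" where
  "inversions w = {(i, j). i < j \<and> w \<langle>$\<rangle> i > w \<langle>$\<rangle> j}"

lemma inv_count_card: "inv_count w = card (inversions w)"
  by (simp add: inv_count_def inversions_def)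

lemma affected_bound:
  fixes w :: "int perm"
  obtains n where "\<And>x. \<bar>x\<bar> \<ge> n \<Longrightarrow> w \<langle>$\<rangle> x = x" "\<And>x. \<bar>x\<bar> < n \<Longrightarrow> \<bar>w \<langle>$\<rangle> x\<bar> < n"
proof -
  define n where "n = Max (insert 0 (abs ` affected w)) + 1"
  have *: "\<bar>x\<bar> < n" if "x \<in> affected w" for x
    unfolding n_def using that by (intro zle_add1_eq_le[THEN iffD2] Max_ge) auto
  have "w \<langle>$\<rangle> x = x" if "\<bar>x\<bar> \<ge> n" for x
    using *[of x] that by (auto simp: in_affected)
  moreover have "\<bar>w \<langle>$\<rangle> x\<bar> < n" if "\<bar>x\<bar> < n" for x
    using *[of "w \<langle>$\<rangle> x"] that by (cases "x \<in> affected w") (auto simp: in_affected apply_inj)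
  ultimately show ?thesis using that by blast
qed

lemma finite_inversions [simp]: "finite (inversions w)"
proof -
  obtain n where n: "\<And>x. \<bar>x\<bar> \<ge> n \<Longrightarrow> w \<langle>$\<rangle> x = x" "\<And>x. \<bar>x\<bar> < n \<Longrightarrow> \<bar>w \<langle>$\<rangle> x\<bar> < n"
    using affected_bound[of w] by metis
  have "inversions w \<subseteq> {-n..n} \<times> {-n..n}"
  proof (clarsimp simp: inversions_def)
    fix i j assume "i < j" "w \<langle>$\<rangle> j < w \<langle>$\<rangle> i"
    then show "- n \<le> i \<and> i \<le> n \<and> - n \<le> j \<and> j \<le> n"
      using n(1)[of i] n(1)[of j] n(2)[of i] n(2)[of j] by (smt (verit))
  qed
  then show ?thesis by (rule finite_subset) simp
qed

text \<open>
  Applying the transposition to both entries of an inversion gives an inversion of the product unless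
  it reverses their order; in that case exactly one entry is \<open>i\<close> or \<open>j\<close>, the other one lies between
  them, and the pair itself is still an inversion. The map \<open>\<phi>\<close> keeps these two kinds apart and misses
  the new inversion \<open>(i, j)\<close>.
\<close>
lemma inversions_swap_subset:
  fixes w :: "int perm"
  assumes "i < j" "w \<langle>$\<rangle> i < w \<langle>$\<rangle> j"
  defines "t \<equiv> \<lambda>x. \<langle>i \<leftrightarrow> j\<rangle> \<langle>$\<rangle> x"
  defines "\<phi> \<equiv> \<lambda>(a, b). if t a < t b then (t a, t b) else (a, b)"
  shows "inj_on \<phi> (inversions w)" "\<phi> ` inversions w \<subseteq> inversions (w * \<langle>i \<leftrightarrow> j\<rangle>) - {(i, j)}"
proof -
  have tt: "t (t x) = x" for x by (simp add: t_def apply_swap_if)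
  then have t_inj: "t a = t b \<longleftrightarrow> a = b" for a b by metis
  show "inj_on \<phi> (inversions w)"
    by (rule inj_onI) (auto simp: \<phi>_def inversions_def tt t_inj split: if_splits)
  show "\<phi> ` inversions w \<subseteq> inversions (w * \<langle>i \<leftrightarrow> j\<rangle>) - {(i, j)}"
    using assms(1,2)
    by (auto simp: \<phi>_def inversions_def apply_mult_swap t_def apply_swap_if split: if_splits)
qed

lemma inv_count_swap_less:
  assumes "i < j" "w \<langle>$\<rangle> i < w \<langle>$\<rangle> j"
  shows "inv_count w < inv_count (w * \<langle>i \<leftrightarrow> j\<rangle>)"
proof -
  note sub = inversions_swap_subset[OF assms]
  have "card (inversions w) \<le> card (inversions (w * \<langle>i \<leftrightarrow> j\<rangle>) - {(i, j)})"
    using card_inj_on_le[OF sub] by simp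
  also have "\<dots> < card (inversions (w * \<langle>i \<leftrightarrow> j\<rangle>))"
    using assms by (intro card_Diff1_less finite_inversions) (simp add: inversions_def apply_mult_swap)
  finally show ?thesis by (simp add: inv_count_card)
qed

lemma inv_count_swap_less_iff:
  assumes "i < j"
  shows "inv_count w < inv_count (w * \<langle>i \<leftrightarrow> j\<rangle>) \<longleftrightarrow> w \<langle>$\<rangle> i < w \<langle>$\<rangle> j"
proof
  assume less: "inv_count w < inv_count (w * \<langle>i \<leftrightarrow> j\<rangle>)"
  show "w \<langle>$\<rangle> i < w \<langle>$\<rangle> j"
  proof (rule ccontr)
    assume "\<not> w \<langle>$\<rangle> i < w \<langle>$\<rangle> j"
    then have "w \<langle>$\<rangle> j < w \<langle>$\<rangle> i"
      using assms apply_inj[of w i j] by auto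
    then have "inv_count (w * \<langle>i \<leftrightarrow> j\<rangle>) < inv_count (w * \<langle>i \<leftrightarrow> j\<rangle> * \<langle>i \<leftrightarrow> j\<rangle>)"
      using assms by (intro inv_count_swap_less) (auto simp: apply_times)
    then show False using less by (simp add: mult.assoc)
  qed
qed (rule inv_count_swap_less[OF assms])

lemma inv_count_ascent:
  assumes "ascent w k"
  shows "inv_count (w * simple_refl k) = inv_count w + 1"
proof -
  let ?t = "\<lambda>x. \<langle>k \<leftrightarrow> k + 1\<rangle> \<langle>$\<rangle> x"
  have t: "?t (?t x) = x" for x by (simp add: apply_swap_if)
  have mono: "?t a < ?t b" if "a < b" "(a, b) \<noteq> (k, k + 1)" for a b
    using that by (auto simp: apply_swap_if)
  have "inversions (w * simple_refl k) = insert (k, k + 1) ((\<lambda>(a, b). (?t a, ?t b)) ` inversions w)"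
    (is "?L = insert _ (?f ` _)")
  proof (intro equalityI subsetI)
    fix p assume "p \<in> ?L"
    then obtain a b where p: "p = (a, b)" "a < b" "w \<langle>$\<rangle> (?t b) < w \<langle>$\<rangle> (?t a)"
      by (auto simp: inversions_def apply_times simple_refl_def)
    show "p \<in> insert (k, k + 1) (?f ` inversions w)"
    proof (cases "(a, b) = (k, k + 1)")
      case False
      then have "p = ?f (?t a, ?t b)" "(?t a, ?t b) \<in> inversions w"
        using p mono by (auto simp: t inversions_def)
      then show ?thesis by blast
    qed (use p in simp)
  next
    fix p assume "p \<in> insert (k, k + 1) (?f ` inversions w)"
    then consider "p = (k, k + 1)" | a b where "p = (?t a, ?t b)" "a < b" "w \<langle>$\<rangle> b < w \<langle>$\<rangle> a"
      by (auto simp: inversions_def)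
    then show "p \<in> ?L"
    proof cases
      case 2
      then have "(a, b) \<noteq> (k, k + 1)" using assms by auto
      then show ?thesis using 2 mono[of a b] t
        by (auto simp: inversions_def apply_times simple_refl_def)
    qed (use assms in \<open>auto simp: inversions_def apply_times simple_refl_def\<close>)
  qed
  moreover have "inj_on ?f (inversions w)"
    by (rule inj_onI) (auto simp: apply_inj)
  moreover have "(k, k + 1) \<notin> ?f ` inversions w"
    using t by (auto simp: inversions_def) (smt (verit) apply_swap_simp assms)
  ultimately show ?thesis by (simp add: inv_count_card card_image)
qed

lemma inverse_apply_eq_iff: "inverse u \<langle>$\<rangle> a = b \<longleftrightarrow> u \<langle>$\<rangle> b = a"
proof -
  have "inverse u \<langle>$\<rangle> (u \<langle>$\<rangle> x) = x" "u \<langle>$\<rangle> (inverse u \<langle>$\<rangle> x) = x" for x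
    by (simp_all add: apply_sequence perm.left_inverse perm.right_inverse)
  then show ?thesis by metis
qed

lemma inv_count_inverse [simp]: "inv_count (inverse w) = inv_count w"
proof -
  have inv: "inverse w \<langle>$\<rangle> (w \<langle>$\<rangle> x) = x" "w \<langle>$\<rangle> (inverse w \<langle>$\<rangle> x) = x" for x
    by (simp_all add: apply_sequence perm.left_inverse perm.right_inverse)
  have "bij_betw (\<lambda>(a, b). (w \<langle>$\<rangle> b, w \<langle>$\<rangle> a)) (inversions w) (inversions (inverse w))"
    by (rule bij_betw_byWitness[where f' = "\<lambda>(a, b). (inverse w \<langle>$\<rangle> b, inverse w \<langle>$\<rangle> a)"])
       (auto simp: inversions_def inv)
  then show ?thesis by (simp add: inv_count_card bij_betw_same_card)
qed

lemma inv_count_one [simp]: "inv_count 1 = 0"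
proof -
  have "inversions 1 = {}" by (auto simp: inversions_def)
  then show ?thesis by (simp add: inv_count_card)
qed

text \<open>
  A permutation without descents is increasing, so \<open>w x - x\<close> is weakly increasing; it vanishes far to
  the left and far to the right.
\<close>
lemma eq_one_if_no_descent:
  assumes "\<And>k. ascent w k"
  shows "w = 1"
proof -
  obtain n where n: "\<And>x. \<bar>x\<bar> \<ge> n \<Longrightarrow> w \<langle>$\<rangle> x = x"
    using affected_bound[of w] by metis
  have mono: "w \<langle>$\<rangle> x + int m \<le> w \<langle>$\<rangle> (x + int m)" for x m
  proof (induction m)
    case (Suc m)
    then show ?case using assms[of "x + int m"] by (simp add: algebra_simps)
  qed simp
  have "w \<langle>$\<rangle> x = x" for x
  proof (rule antisym)
    show "w \<langle>$\<rangle> x \<le> x"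
      using mono[of x "nat (\<bar>n\<bar> + \<bar>x\<bar>)"] n[of "x + (\<bar>n\<bar> + \<bar>x\<bar>)"] by simp
    show "x \<le> w \<langle>$\<rangle> x"
      using mono[of "x - (\<bar>n\<bar> + \<bar>x\<bar>)" "nat (\<bar>n\<bar> + \<bar>x\<bar>)"] n[of "x - (\<bar>n\<bar> + \<bar>x\<bar>)"] by simp
  qed
  then show ?thesis by (intro perm_eqI) simp
qed

lemma perm_ascent_induct [case_names one ascent]:
  assumes "P 1" and "\<And>w k. ascent w k \<Longrightarrow> P w \<Longrightarrow> P (w * simple_refl k)"
  shows "P w"
proof (induction "inv_count w" arbitrary: w rule: less_induct)
  case less
  show ?case
  proof (cases "\<forall>k. ascent w k")
    case True
    then show ?thesis using eq_one_if_no_descent assms(1) by metis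
  next
    case False
    then obtain k where k: "ascent (w * simple_refl k) k" by (metis ascent_mult_simple_refl)
    then have "inv_count (w * simple_refl k) < inv_count w" using inv_count_ascent[OF k] by simp
    then show ?thesis using assms(2)[OF k] less by simp
  qed
qed

section \<open>The Demazure product\<close>

text \<open>
  The left and right multiplications by one generator \<open>s\<^sub>k\<close> in the Demazure product. Everything
  about that product rests on the fact that they commute (\<open>dem_left_right_commute\<close>), since every
  permutation is reached from \<open>1\<close> by operators of either kind.
\<close>
definition dem_right :: "int \<Rightarrow> int perm \<Rightarrow> int perm" where
  "dem_right k u = (if ascent u k then u * simple_refl k else u)"

definition dem_left :: "int \<Rightarrow> int perm \<Rightarrow> int perm" where
  "dem_left k u = inverse (dem_right k (inverse u))"

lemma dem_left_eq: "dem_left k u = (if ascent (inverse u) k then simple_refl k * u else u)"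
  by (simp add: dem_left_def dem_right_def)

lemma inverse_dem_right: "inverse (dem_right k u) = dem_left k (inverse u)"
  by (simp add: dem_left_def)

lemma inverse_dem_left: "inverse (dem_left k u) = dem_right k (inverse u)"
  by (simp add: dem_left_def)

lemma ascent_simple_refl_mult:
  assumes "{u \<langle>$\<rangle> l, u \<langle>$\<rangle> (l + 1)} \<noteq> {k, k + 1}"
  shows "ascent (simple_refl k * u) l \<longleftrightarrow> ascent u l"
  using assms apply_inj[of u l "l + 1"]
  by (auto simp: apply_times apply_simple_refl doubleton_eq_iff)

text \<open>
  Left multiplication by \<open>s\<^sub>k\<close> affects the comparison of \<open>u l\<close> and \<open>u (l + 1)\<close> only if these two values
  are \<open>k\<close> and \<open>k + 1\<close>, and in that case \<open>s\<^sub>k u = u s\<^sub>l\<close>.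
\<close>
lemma dem_left_right_commute: "dem_left k (dem_right l u) = dem_right l (dem_left k u)"
proof -
  let ?v = "inverse u"
  consider "u \<langle>$\<rangle> l = k" "u \<langle>$\<rangle> (l + 1) = k + 1" | "u \<langle>$\<rangle> l = k + 1" "u \<langle>$\<rangle> (l + 1) = k"
    | "{u \<langle>$\<rangle> l, u \<langle>$\<rangle> (l + 1)} \<noteq> {k, k + 1}"
    by (auto simp: doubleton_eq_iff)
  then show ?thesis
  proof cases
    case 1
    then have v: "?v \<langle>$\<rangle> k = l" "?v \<langle>$\<rangle> (k + 1) = l + 1" by (auto simp: inverse_apply_eq_iff)
    have "simple_refl k * u = u * simple_refl l"
    proof (rule perm_eqI)
      fix x
      have "u \<langle>$\<rangle> x = k \<longleftrightarrow> x = l" "u \<langle>$\<rangle> x = k + 1 \<longleftrightarrow> x = l + 1"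
        using 1 by (metis apply_inj)+
      then show "(simple_refl k * u) \<langle>$\<rangle> x = (u * simple_refl l) \<langle>$\<rangle> x"
        using 1 by (cases "x = l \<or> x = l + 1") (auto simp: apply_times apply_simple_refl)
    qed
    then show ?thesis using 1 v
      by (auto simp: dem_left_eq dem_right_def apply_times apply_simple_refl)
  next
    case 2
    then have "?v \<langle>$\<rangle> k = l + 1" "?v \<langle>$\<rangle> (k + 1) = l" by (auto simp: inverse_apply_eq_iff)
    then show ?thesis using 2 by (auto simp: dem_left_eq dem_right_def)
  next
    case 3
    then have "{?v \<langle>$\<rangle> k, ?v \<langle>$\<rangle> (k + 1)} \<noteq> {l, l + 1}"
      by (auto simp: doubleton_eq_iff inverse_apply_eq_iff)
    then show ?thesis using 3 ascent_simple_refl_mult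
      by (auto simp: dem_left_eq dem_right_def mult.assoc)
  qed
qed

lemma fold_dem_right_left: "fold dem_right ks (dem_left k u) = dem_left k (fold dem_right ks u)"
  by (induction ks arbitrary: u) (simp_all flip: dem_left_right_commute)

lemma dem_left_induct [case_names one left]:
  assumes "P 1" and "\<And>u k. P u \<Longrightarrow> P (dem_left k u)"
  shows "P u"
proof -
  have "P (inverse v)" for v
  proof (induction v rule: perm_ascent_induct)
    case (ascent w k)
    have "inverse (w * simple_refl k) = dem_left k (inverse w)"
      using ascent by (simp add: dem_left_eq)
    then show ?case using assms(2)[OF ascent(2)] by simp
  qed (use assms(1) in simp)
  from this[of "inverse u"] show ?thesis by simp
qed

text \<open>
  The word is arbitrary, not necessarily reduced: by \<open>fold_dem_right_cong\<close> all words that take \<open>1\<close>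
  to \<open>v\<close> act in the same way.
\<close>
definition dem_prod :: "int perm \<Rightarrow> int perm \<Rightarrow> int perm" where
  "dem_prod u v = fold dem_right (SOME ks. fold dem_right ks 1 = v) u"

lemma ex_dem_word: "\<exists>ks. fold dem_right ks 1 = v"
proof (induction v rule: perm_ascent_induct)
  case one
  then show ?case by (intro exI[of _ "[]"]) simp
next
  case (ascent w k)
  then obtain ks where "fold dem_right ks 1 = w" by blast
  then have "fold dem_right (ks @ [k]) 1 = w * simple_refl k"
    using ascent(1) by (simp add: dem_right_def[of k w])
  then show ?case by blast
qed

text \<open>
  Write \<open>u\<close> as the result of left operators on \<open>1\<close> and move these past both words.
\<close>
lemma fold_dem_right_cong:
  assumes "fold dem_right ks 1 = fold dem_right ls 1"
  shows "fold dem_right ks u = fold dem_right ls u"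
  using assms by (induction u rule: dem_left_induct) (simp_all add: fold_dem_right_left)

lemma dem_prod_word: "fold dem_right ks 1 = v \<Longrightarrow> dem_prod u v = fold dem_right ks u"
  unfolding dem_prod_def by (rule fold_dem_right_cong) (metis (mono_tags, lifting) someI)

lemma dem_prod_one [simp]: "dem_prod u 1 = u"
  using dem_prod_word[of "[]"] by simp

lemma dem_prod_dem_right: "dem_prod u (dem_right k v) = dem_right k (dem_prod u v)"
proof -
  obtain ks where ks: "fold dem_right ks 1 = v" using ex_dem_word by blast
  then have "fold dem_right (ks @ [k]) 1 = dem_right k v" by simp
  from dem_prod_word[OF this] dem_prod_word[OF ks] show ?thesis by simp
qed

lemma dem_prod_ascent: "ascent v k \<Longrightarrow> dem_prod u (v * simple_refl k) = dem_right k (dem_prod u v)"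
  using dem_prod_dem_right[of u k v] by (simp add: dem_right_def)

lemma dem_prod_dem_left: "dem_prod (dem_left k u) v = dem_left k (dem_prod u v)"
  using ex_dem_word[of v] dem_prod_word fold_dem_right_left by metis

lemma inv_count_mult_simple_refl_le: "inv_count (u * simple_refl k) \<le> inv_count u + 1"
  using inv_count_ascent[of u k] inv_count_ascent[of "u * simple_refl k" k] ascent_cases[of u k]
  by fastforce

lemma inv_count_mult_le: "inv_count (u * v) \<le> inv_count u + inv_count v"
proof (induction v rule: perm_ascent_induct)
  case (ascent v k)
  then show ?case using inv_count_mult_simple_refl_le[of "u * v" k] inv_count_ascent[of v k]
    by (simp flip: mult.assoc)
qed simp

lemma is_demazure_dem_prod: "is_demazure dem_prod"
  unfolding is_demazure_def
proof (intro conjI allI impI)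
  fix u v w
  show "dem_prod (dem_prod u v) w = dem_prod u (dem_prod v w)"
    by (induction w rule: perm_ascent_induct) (simp_all add: dem_prod_ascent dem_prod_dem_right)
next
  fix u v :: "int perm"
  assume "inv_count (u * v) = inv_count u + inv_count v"
  then show "dem_prod u v = u * v"
  proof (induction v rule: perm_ascent_induct)
    case (ascent v k)
    have eq: "inv_count (u * v * simple_refl k) = inv_count u + inv_count v + 1"
      using ascent inv_count_ascent[of v k] by (simp add: mult.assoc)
    then have uv: "inv_count (u * v) = inv_count u + inv_count v"
      using inv_count_mult_le[of u v] inv_count_mult_simple_refl_le[of "u * v" k] by simp
    then have "ascent (u * v) k"
      using eq inv_count_ascent[of "u * v * simple_refl k" k] ascent_cases[of "u * v" k] by fastforce
    then show ?case using ascent uv by (simp add: dem_prod_ascent dem_right_def mult.assoc)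
  qed simp
next
  fix i
  have "dem_prod (simple_refl i) (1 * simple_refl i) = simple_refl i"
    by (subst dem_prod_ascent) (simp_all add: dem_right_def apply_simple_refl)
  then show "dem_prod (simple_refl i) (simple_refl i) = simple_refl i" by simp
qed

text \<open>
  If \<open>k\<close> is a descent of \<open>u\<close>, then \<open>u = (u s\<^sub>k) \<circ> s\<^sub>k\<close>, and idempotence of \<open>s\<^sub>k\<close> absorbs the
  second factor.
\<close>
lemma is_demazure_simple_refl:
  assumes "is_demazure d"
  shows "d u (simple_refl k) = dem_right k u"
proof -
  have len: "inv_count (simple_refl k) = 1"
    using inv_count_ascent[of 1 k] by simp
  have mult: "d u (simple_refl k) = u * simple_refl k" if "ascent u k" for u
    using assms inv_count_ascent[OF that] len by (simp add: is_demazure_def)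
  show ?thesis
  proof (cases "ascent u k")
    case False
    let ?v = "u * simple_refl k"
    have "u = d ?v (simple_refl k)"
      using mult[of ?v] False ascent_mult_simple_refl[of u k] by simp
    then have "d u (simple_refl k) = d (d ?v (simple_refl k)) (simple_refl k)" by simp
    also have "\<dots> = d ?v (simple_refl k)"
      using assms by (simp add: is_demazure_def)
    finally show ?thesis using \<open>u = d ?v (simple_refl k)\<close> False by (simp add: dem_right_def)
  qed (simp add: mult dem_right_def)
qed

lemma is_demazure_unique:
  assumes "is_demazure d"
  shows "d = dem_prod"
proof (intro ext)
  fix u v
  show "d u v = dem_prod u v"
  proof (induction v rule: perm_ascent_induct)
    case one
    then show ?case using assms by (simp add: is_demazure_def)
  next
    case (ascent v k)
    have "d u (v * simple_refl k) = d u (d v (simple_refl k))"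
      using ascent by (simp add: is_demazure_simple_refl[OF assms] dem_right_def)
    also have "\<dots> = d (d u v) (simple_refl k)"
      using assms by (simp add: is_demazure_def)
    finally show ?case
      using ascent by (simp add: is_demazure_simple_refl[OF assms] dem_prod_ascent)
  qed
qed

lemma demazure_eq: "demazure = dem_prod"
  unfolding demazure_def by (rule the_equality) (auto simp: is_demazure_dem_prod is_demazure_unique)

section \<open>Atoms along ascents\<close>

definition involution_of :: "int perm \<Rightarrow> int perm" where
  "involution_of w = demazure (inverse w) w"

definition dem_conj :: "int \<Rightarrow> int perm \<Rightarrow> int perm" where
  "dem_conj k y = dem_left k (dem_right k y)"

lemma involution_of_one [simp]: "involution_of 1 = 1"
  by (simp add: involution_of_def demazure_eq)

lemma involution_of_ascent:
  assumes "ascent w k"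
  shows "involution_of (w * simple_refl k) = dem_conj k (involution_of w)"
proof -
  have "inverse (w * simple_refl k) = dem_left k (inverse w)"
    using assms by (simp add: dem_left_eq)
  then show ?thesis using assms
    by (simp add: involution_of_def demazure_eq dem_prod_ascent dem_prod_dem_left dem_conj_def
        dem_left_right_commute del: perm.inverse_distrib_swap)
qed

lemma involutions_apply: "y \<in> involutions \<longleftrightarrow> (\<forall>x. y \<langle>$\<rangle> (y \<langle>$\<rangle> x) = x)"
proof
  assume "y \<in> involutions"
  then have "inverse y = y" by (simp add: involutions_def)
  then show "\<forall>x. y \<langle>$\<rangle> (y \<langle>$\<rangle> x) = x" using inverse_apply_eq_iff[of y] by metis
next
  assume "\<forall>x. y \<langle>$\<rangle> (y \<langle>$\<rangle> x) = x"
  then have "inverse y = y" by (intro perm_eqI) (simp add: inverse_apply_eq_iff)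
  then show "y \<in> involutions" by (simp add: involutions_def)
qed

lemma dem_conj_involution: "y \<in> involutions \<Longrightarrow> dem_conj k y \<in> involutions"
  by (simp add: involutions_def dem_conj_def inverse_dem_left inverse_dem_right
      dem_left_right_commute)

lemma dem_conj_descent: "y \<in> involutions \<Longrightarrow> \<not> ascent y k \<Longrightarrow> dem_conj k y = y"
  by (simp add: dem_conj_def dem_right_def dem_left_eq involutions_def)

lemma dem_conj_ascent:
  assumes y: "y \<in> involutions" and asc: "ascent y k"
  shows "dem_conj k y = (if y \<langle>$\<rangle> k = k \<and> y \<langle>$\<rangle> (k + 1) = k + 1
    then y * simple_refl k else simple_refl k * y * simple_refl k)"
proof -
  have inv: "inverse y = y" using y by (simp add: involutions_def)
  show ?thesis
  proof (cases "y \<langle>$\<rangle> k = k \<and> y \<langle>$\<rangle> (k + 1) = k + 1")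
    case True
    then show ?thesis using inv asc
      by (simp add: dem_conj_def dem_right_def dem_left_eq apply_times apply_simple_refl)
  next
    case False
    then have "{y \<langle>$\<rangle> k, y \<langle>$\<rangle> (k + 1)} \<noteq> {k, k + 1}" using asc by (auto simp: doubleton_eq_iff)
    then have "ascent (simple_refl k * y) k" using asc ascent_simple_refl_mult by blast
    moreover have "dem_conj k y = dem_left k (y * simple_refl k)"
      using asc by (simp add: dem_conj_def dem_right_def)
    ultimately show ?thesis
      using inv by (subst if_not_P[OF False]) (simp add: dem_left_eq mult.assoc)
  qed
qed

lemma not_ascent_dem_conj:
  assumes "y \<in> involutions"
  shows "\<not> ascent (dem_conj k y) k"
proof (cases "ascent y k")
  case True
  then show ?thesis
    by (simp add: dem_conj_def dem_left_right_commute)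
       (simp add: dem_right_def ascent_mult_simple_refl)
qed (simp add: dem_conj_descent[OF assms])

text \<open>
  A quarter of this number is the length of every atom of \<open>y\<close> (\<open>atoms_iff_height\<close>).
\<close>
definition height :: "int perm \<Rightarrow> nat" where
  "height y = 2 * inv_count y + card (affected y)"

lemma height_one [simp]: "height 1 = 0"
  by (simp add: height_def)

text \<open>
  Either two points that were fixed become a 2-cycle and the length grows by one, or \<open>y\<close> is conjugated
  and the length grows by two while the number of moved points stays the same.
\<close>
lemma height_dem_conj:
  assumes y: "y \<in> involutions" and asc: "ascent y k"
  shows "height (dem_conj k y) = height y + 4"
proof (cases "y \<langle>$\<rangle> k = k \<and> y \<langle>$\<rangle> (k + 1) = k + 1")
  case True
  then have "affected (y * simple_refl k) = insert k (insert (k + 1) (affected y))"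
    by (auto simp: in_affected apply_mult_simple_refl split: if_splits)
  moreover have "card (insert k (insert (k + 1) (affected y))) = card (affected y) + 2"
    using True by (simp add: card_insert_if in_affected)
  ultimately show ?thesis
    using True by (simp add: dem_conj_ascent[OF assms] height_def inv_count_ascent[OF asc])
next
  case False
  let ?s = "simple_refl k"
  have inv: "inverse y = y" using y by (simp add: involutions_def)
  have "{y \<langle>$\<rangle> k, y \<langle>$\<rangle> (k + 1)} \<noteq> {k, k + 1}" using False asc by (auto simp: doubleton_eq_iff)
  then have asc': "ascent (?s * y) k" using asc ascent_simple_refl_mult by blast
  have "inv_count (?s * y) = inv_count (inverse (?s * y))" by (simp only: inv_count_inverse)
  also have "\<dots> = inv_count y + 1" by (simp add: inv inv_count_ascent[OF asc])
  finally have len: "inv_count (?s * y * ?s) = inv_count y + 2"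
    by (simp add: inv_count_ascent[OF asc'])
  have "affected (?s * y * ?s) = apply ?s ` affected y"
  proof (intro equalityI subsetI)
    fix x assume "x \<in> affected (?s * y * ?s)"
    then have "?s \<langle>$\<rangle> x \<in> affected y" "x = ?s \<langle>$\<rangle> (?s \<langle>$\<rangle> x)"
      by (auto simp: in_affected apply_times apply_simple_refl split: if_splits)
    then show "x \<in> apply ?s ` affected y" by blast
  qed (auto simp: in_affected apply_times apply_simple_refl split: if_splits)
  moreover have "inj_on (apply ?s) (affected y)" by (simp add: inj_on_def apply_inj)
  ultimately show ?thesis
    unfolding dem_conj_ascent[OF assms] if_not_P[OF False] height_def
    using len by (simp add: card_image)
qed

lemma involution_of_involution: "involution_of w \<in> involutions"
proof (induction w rule: perm_ascent_induct)
  case one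
  then show ?case by (simp add: involutions_def)
qed (simp add: involution_of_ascent dem_conj_involution)

lemma height_involution_of_le: "height (involution_of w) \<le> 4 * inv_count w"
proof (induction w rule: perm_ascent_induct)
  case (ascent w k)
  have "height (dem_conj k (involution_of w)) \<le> height (involution_of w) + 4"
    using height_dem_conj[OF involution_of_involution, of w k]
      dem_conj_descent[OF involution_of_involution, of w k] by fastforce
  then show ?case using ascent by (simp add: involution_of_ascent inv_count_ascent)
qed simp

lemma atoms_iff_minimal:
  "w \<in> atoms y \<longleftrightarrow> y = involution_of w \<and> (\<forall>v. involution_of v = y \<longrightarrow> inv_count w \<le> inv_count v)"
  by (auto simp: atoms_def is_arg_min_def involution_of_def not_less)

text \<open>
  A permutation shorter than \<open>w\<close> with the same involution, or an unchanged involution in the last step,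
  would give a permutation shorter than \<open>w s\<^sub>k\<close> with involution \<open>z\<close>.
\<close>
lemma atom_ascent_strict:
  assumes asc: "ascent w k" and atom: "w * simple_refl k \<in> atoms z"
  shows "w \<in> atoms (involution_of w)" "ascent (involution_of w) k"
proof -
  let ?y = "involution_of w"
  have z: "z = dem_conj k ?y" and min: "involution_of v = z \<Longrightarrow> inv_count w + 1 \<le> inv_count v" for v
    using atom by (auto simp: atoms_iff_minimal involution_of_ascent[OF asc] inv_count_ascent[OF asc])
  show "ascent ?y k"
    using z min[of w] dem_conj_descent[OF involution_of_involution, of w k] by fastforce
  have "inv_count w \<le> inv_count v" if "involution_of v = ?y" for v
  proof (cases "ascent v k")
    case True
    then show ?thesis
      using min[of "v * simple_refl k"] z that by (simp add: involution_of_ascent inv_count_ascent)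
  next
    case False
    let ?v = "v * simple_refl k"
    have "ascent ?v k" using False ascent_mult_simple_refl by blast
    then have "?y = dem_conj k (involution_of ?v)"
      using involution_of_ascent[of ?v k] that by simp
    then have "\<not> ascent ?y k"
      using not_ascent_dem_conj[OF involution_of_involution] by metis
    then have "dem_conj k ?y = ?y" using dem_conj_descent[OF involution_of_involution] by metis
    then show ?thesis using min[of v] z that by simp
  qed
  then show "w \<in> atoms ?y" by (simp add: atoms_iff_minimal)
qed

lemma atoms_iff_height:
  "w \<in> atoms y \<longleftrightarrow> y = involution_of w \<and> height y = 4 * inv_count w"
proof (intro iffI conjI)
  assume "w \<in> atoms y"
  then show "height y = 4 * inv_count w"
  proof (induction w arbitrary: y rule: perm_ascent_induct)
    case one
    then show ?case by (simp add: atoms_iff_minimal)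
  next
    case (ascent w k)
    note strict = atom_ascent_strict[OF ascent.hyps ascent.prems]
    have "y = dem_conj k (involution_of w)"
      using ascent by (simp add: atoms_iff_minimal involution_of_ascent)
    then show ?case
      using ascent.IH[OF strict(1)] height_dem_conj[OF involution_of_involution strict(2)]
      by (simp add: inv_count_ascent[OF ascent.hyps])
  qed
next
  assume y: "y = involution_of w \<and> height y = 4 * inv_count w"
  have "inv_count w \<le> inv_count v" if "involution_of v = y" for v
    using height_involution_of_le[of v] that y by auto
  with y show "w \<in> atoms y" by (simp add: atoms_iff_minimal)
qed (simp add: atoms_iff_minimal)

lemma atoms_unique: "w \<in> atoms y \<Longrightarrow> w \<in> atoms z \<Longrightarrow> y = z"
  by (simp add: atoms_iff_height)

lemma atoms_involution: "w \<in> atoms y \<Longrightarrow> y \<in> involutions"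
  by (simp add: atoms_iff_height involution_of_involution)

lemma one_atoms_iff: "1 \<in> atoms y \<longleftrightarrow> y = 1"
  by (auto simp: atoms_iff_height)

text \<open>
  The only property of atoms, besides \<open>one_atoms_iff\<close>, that the inductions below use.
\<close>
lemma atoms_ascent_iff:
  assumes "ascent w k"
  shows "w * simple_refl k \<in> atoms z \<longleftrightarrow> (\<exists>y. w \<in> atoms y \<and> ascent y k \<and> z = dem_conj k y)"
proof
  assume atom: "w * simple_refl k \<in> atoms z"
  then have "z = dem_conj k (involution_of w)"
    by (simp add: atoms_iff_height involution_of_ascent[OF assms])
  then show "\<exists>y. w \<in> atoms y \<and> ascent y k \<and> z = dem_conj k y"
    using atom_ascent_strict[OF assms atom] by blast
next
  assume "\<exists>y. w \<in> atoms y \<and> ascent y k \<and> z = dem_conj k y"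
  then show "w * simple_refl k \<in> atoms z"
    by (auto simp: atoms_iff_height involution_of_ascent[OF assms] inv_count_ascent[OF assms]
        height_dem_conj[OF involution_of_involution])
qed

section \<open>Local description of atoms\<close>

text \<open>
  In the word \<open>w\<inverse> 1, w\<inverse> 2, \<dots>\<close> the larger entry of each 2-cycle of \<open>y\<close> comes first, no number in
  between them by size also comes in between them by place, and two cycles whose smaller and whose
  larger entries compare in the same way are separated accordingly. In the last condition \<open>x\<close> and \<open>x'\<close>
  range over all points and not only over the smaller entries of cycles; this is equivalent and
  treats fixed points and both entries of a 2-cycle alike.
\<close>
definition atom_pattern :: "(int \<Rightarrow> int) \<Rightarrow> (int \<Rightarrow> int) \<Rightarrow> bool" where
  "atom_pattern w y \<longleftrightarrow>
     (\<forall>x. x < y x \<longrightarrow> w (y x) < w x) \<and>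
     (\<forall>x e. x < e \<longrightarrow> e < y x \<longrightarrow> \<not> (w (y x) < w e \<and> w e < w x)) \<and>
     (\<forall>x x'. x < x' \<longrightarrow> y x < y x' \<longrightarrow> w x < w (y x'))"

lemma atom_patternD:
  assumes "atom_pattern w y"
  shows "x < y x \<Longrightarrow> w (y x) < w x"
    and "x < e \<Longrightarrow> e < y x \<Longrightarrow> \<not> (w (y x) < w e \<and> w e < w x)"
    and "x < x' \<Longrightarrow> y x < y x' \<Longrightarrow> w x < w (y x')"
  using assms by (auto simp: atom_pattern_def)

lemma atom_pattern_cycle_le:
  assumes "atom_pattern w y" "x \<le> y x"
  shows "w (y x) \<le> w x"
  using atom_patternD(1)[OF assms(1), of x] assms(2) by (cases "y x = x") auto

text \<open>
  If \<open>y k < y (k + 1)\<close>, the third condition gives \<open>w k < w (y (k + 1))\<close> and \<open>w (y k) < w (k + 1)\<close>. With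
  the first condition, \<open>w (k + 1) < w k\<close> would then force \<open>y (k + 1) \<le> k < y k\<close>.
\<close>
lemma atom_pattern_descent:
  assumes pat: "atom_pattern w y" and inv: "\<And>x. y (y x) = x"
    and desc: "w (k + 1) < w k"
  shows "y (k + 1) < y k"
proof (rule ccontr)
  assume "\<not> ?thesis"
  moreover have "y (k + 1) \<noteq> y k" by (metis inv less_irrefl zless_add1_eq)
  ultimately have less: "y k < y (k + 1)" by simp
  have 1: "w k < w (y (k + 1))" using atom_patternD(3)[OF pat, of k "k + 1"] less by simp
  have 2: "w (y k) < w (k + 1)"
    using atom_patternD(3)[OF pat, of "y k" "y (k + 1)"] less by (simp add: inv)
  have "y (k + 1) < k + 1"
    using 1 desc atom_pattern_cycle_le[OF pat, of "k + 1"] by (cases "k + 1 \<le> y (k + 1)") simp_all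
  moreover have "k < y k"
    using 2 desc atom_pattern_cycle_le[OF pat, of "y k"] by (cases "y k \<le> k") (simp_all add: inv)
  ultimately show False using less by simp
qed

text \<open>
  Conjugating \<open>y\<close> while multiplying \<open>w\<close> by \<open>s\<^sub>k\<close> relabels the points by \<open>s\<close>, so the conditions on the
  values are the same and only their premises, the comparisons of points, change. These change only
  for the pair \<open>(k, k + 1)\<close>. One statement serves for both directions because the hypothesis allows an
  ascent as well as a descent.
\<close>
lemma atom_pattern_conj:
  fixes k :: int
  defines "s \<equiv> \<lambda>x. if x = k then k + 1 else if x = k + 1 then k else x"
  assumes inv: "\<And>x. y (y x) = x" and inj: "inj w"
    and pat: "atom_pattern w y"
    and nofix: "y k \<noteq> k \<or> y (k + 1) \<noteq> k + 1" and nocyc: "y k \<noteq> k + 1"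
    and w_y: "w k < w (k + 1) \<and> y k < y (k + 1) \<or> w (k + 1) < w k \<and> y (k + 1) < y k"
  shows "atom_pattern (\<lambda>x. w (s x)) (\<lambda>x. s (y (s x)))"
proof -
  have s: "s (s x) = x" for x by (simp add: s_def)
  have less: "s a < s b \<longleftrightarrow> (a < b \<and> (a, b) \<noteq> (k, k + 1)) \<or> (a, b) = (k + 1, k)" for a b
    by (auto simp: s_def)
  have inj: "w a = w b \<longleftrightarrow> a = b" for a b using inj by (simp add: inj_eq)
  have y_eq: "y a = b \<longleftrightarrow> a = y b" for a b using inv by metis
  note D = atom_patternD[OF pat]
  have 1: "w (y u) < w u" if "s u < s (y u)" for u
  proof -
    have "(u, y u) \<noteq> (k + 1, k)" using nocyc inv by (metis prod.inject)
    then show ?thesis using that D(1)[of u] by (auto simp: less)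
  qed
  have 2: "\<not> (w (y u) < w e \<and> w e < w u)" if "s u < s e" "s e < s (y u)" for u e
    using that D(1)[of u] D(2)[of u e] D(3)[of k "k + 1"] D(3)[of "y k" "y (k + 1)"] w_y inv
    by (smt (verit) less prod.inject)
  have 3: "w u < w (y v)" if uv: "s u < s v" "s (y u) < s (y v)" for u v
  proof -
    \<comment> \<open>As \<open>s\<close> reverses only the pair \<open>(k, k + 1)\<close>, at most one of the two comparisons is new.\<close>
    consider "u < v" "y u < y v" | "u = k + 1" "v = k" | "y u = k + 1" "y v = k"
      using uv by (auto simp: less)
    then show ?thesis
    proof cases
      case 1
      then show ?thesis by (rule D(3))
    next
      case 2
      then show ?thesis
        using uv less[of "y (k + 1)" "y k"] w_y nocyc nofix inj[of "k + 1" "y k"] inv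
          D(1)[of k] D(1)[of "k + 1"] D(1)[of "y k"] D(1)[of "y (k + 1)"] D(2)[of k "k + 1"]
          D(3)[of "y (k + 1)" k]
        by (smt (verit) prod.inject)
    next
      case 3
      then have "u = y (k + 1)" "v = y k" using inv by metis+
      then show ?thesis
        using 3 uv less[of "y (k + 1)" "y k"] w_y nocyc nofix inj[of "y (k + 1)" "k"] inv
          D(1)[of k] D(1)[of "k + 1"] D(1)[of "y k"] D(1)[of "y (k + 1)"] D(2)[of "y (k + 1)" "k"]
          D(3)[of "y (k + 1)" k]
        by (smt (verit) prod.inject)
    qed
  qed
  show ?thesis unfolding atom_pattern_def
  proof (intro conjI allI impI)
    fix x x' e
    show "w (s (s (y (s x)))) < w (s x)" if "x < s (y (s x))"
      using 1[of "s x"] that by (simp add: s)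
    show "\<not> (w (s (s (y (s x)))) < w (s e) \<and> w (s e) < w (s x))" if "x < e" "e < s (y (s x))"
      using 2[of "s x" "s e"] that by (simp add: s)
    show "w (s x) < w (s (s (y (s x'))))" if "x < x'" "s (y (s x)) < s (y (s x'))"
      using 3[of "s x" "s x'"] that by (simp add: s)
  qed
qed

text \<open>
  The step between two fixed points \<open>k\<close>, \<open>k + 1\<close> and the 2-cycle formed by them, in either direction. No
  point lies between \<open>k\<close> and \<open>k + 1\<close>, so every other cycle is in the same position to both of them.
\<close>
lemma atom_pattern_toggle_cycle:
  fixes k :: int
  defines "s \<equiv> \<lambda>x. if x = k then k + 1 else if x = k + 1 then k else x"
  assumes inv: "\<And>x. y (y x) = x" 
    and pat: "atom_pattern w y"
    and y: "y k = k \<and> y (k + 1) = k + 1 \<and> w k < w (k + 1) \<or> y k = k + 1"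
  shows "atom_pattern (\<lambda>x. w (s x)) (\<lambda>x. y (s x))"
proof -
  note D = atom_patternD[OF pat]
  have s: "s k = k + 1" "s (k + 1) = k" "\<And>x. x \<noteq> k \<Longrightarrow> x \<noteq> k + 1 \<Longrightarrow> s x = x"
    by (auto simp: s_def)
  have yk: "{y k, y (k + 1)} = {k, k + 1}" using y inv[of k] by auto
  then have yx: "y x \<noteq> k \<and> y x \<noteq> k + 1" if "x \<noteq> k" "x \<noteq> k + 1" for x
    using inv that by (metis doubleton_eq_iff)
  show ?thesis unfolding atom_pattern_def
  proof (intro conjI allI impI)
    fix x x' e
    show "w (s (y (s x))) < w (s x)" if "x < y (s x)"
      using that y s yx D(1)[of x] inv[of k] by (smt (verit))
    show "\<not> (w (s (y (s x))) < w (s e) \<and> w (s e) < w (s x))" if "x < e" "e < y (s x)"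
      using that y s yx D(2)[of x e] D(2)[of x k] D(2)[of x "k + 1"] inv[of k] by (smt (verit))
    show "w (s x) < w (s (y (s x')))" if "x < x'" "y (s x) < y (s x')"
      using that y s yx D(1)[of k] D(3)[of x x'] D(3)[of k x'] D(3)[of "k + 1" x'] D(3)[of x k]
        D(3)[of x "k + 1"] inv[of k]
      by (smt (verit))
  qed
qed

lemma apply_mult_simple_refl_fun:
  "apply (w * simple_refl k) = (\<lambda>x. w \<langle>$\<rangle> (if x = k then k + 1 else if x = k + 1 then k else x))"
  by (rule ext) (simp add: apply_mult_simple_refl)

lemma apply_conj_simple_refl_fun:
  "apply (simple_refl k * y * simple_refl k) =
    (\<lambda>x. (\<lambda>x. if x = k then k + 1 else if x = k + 1 then k else x)
      (y \<langle>$\<rangle> (if x = k then k + 1 else if x = k + 1 then k else x)))"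
  by (rule ext) (simp add: apply_times apply_simple_refl)

lemma atom_pattern_one:
  assumes "y \<in> involutions" "atom_pattern id (apply y)"
  shows "y = 1"
proof (rule perm_eqI)
  fix x
  have le: "y \<langle>$\<rangle> x \<le> x" for x
    using atom_patternD(1)[OF assms(2), of x] by (force simp: not_le[symmetric])
  have "y \<langle>$\<rangle> (y \<langle>$\<rangle> x) = x" using assms(1) by (simp add: involutions_apply)
  then show "y \<langle>$\<rangle> x = 1 \<langle>$\<rangle> x" using le[of x] le[of "y \<langle>$\<rangle> x"] by simp
qed

lemma simple_refl_twice: "simple_refl k \<langle>$\<rangle> (simple_refl k \<langle>$\<rangle> x) = x"
  by (simp add: apply_simple_refl)

text \<open>
  Induction along ascents of \<open>w\<close>. An ascent step of \<open>w\<close> that is strict on \<open>y\<close> transforms the local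
  conditions by one of the two lemmas above. Conversely, a descent \<open>k\<close> of \<open>w s\<^sub>k\<close> is a descent of \<open>z\<close> by
  \<open>atom_pattern_descent\<close>, so that \<open>z\<close> arises from a smaller involution by a strict step.
\<close>
lemma atoms_iff_pattern: "w \<in> atoms y \<longleftrightarrow> y \<in> involutions \<and> atom_pattern (apply w) (apply y)"
proof (induction w arbitrary: y rule: perm_ascent_induct)
  case one
  show ?case using atom_pattern_one
    by (auto simp: one_atoms_iff involutions_apply atom_pattern_def)
next
  case (ascent w k z)
  let ?s = "simple_refl k"
  have inj: "inj (apply w)" for w :: "int perm" by (simp add: inj_def apply_inj)
  show ?case
  proof
    assume "w * ?s \<in> atoms z"
    then obtain y where y: "w \<in> atoms y" "ascent y k" "z = dem_conj k y"
      using atoms_ascent_iff[OF ascent.hyps] by blast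
    then have inv: "y \<in> involutions" and pat: "atom_pattern (apply w) (apply y)"
      using ascent.IH by auto
    have yy: "y \<langle>$\<rangle> (y \<langle>$\<rangle> x) = x" for x using inv by (simp add: involutions_apply)
    have "atom_pattern (apply (w * ?s)) (apply z)"
    proof (cases "y \<langle>$\<rangle> k = k \<and> y \<langle>$\<rangle> (k + 1) = k + 1")
      case True
      then show ?thesis
        unfolding y(3) dem_conj_ascent[OF inv y(2)] if_P[OF True] apply_mult_simple_refl_fun
        using atom_pattern_toggle_cycle[OF yy pat] ascent.hyps by simp
    next
      case False
      moreover have "y \<langle>$\<rangle> k \<noteq> k + 1" using y(2) yy[of k] by auto
      ultimately show ?thesis
        unfolding y(3) dem_conj_ascent[OF inv y(2)] if_not_P[OF False]
          apply_mult_simple_refl_fun[of w] apply_conj_simple_refl_fun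
        using atom_pattern_conj[OF yy inj pat, of k] ascent.hyps y(2) by blast
    qed
    then show "z \<in> involutions \<and> atom_pattern (apply (w * ?s)) (apply z)"
      using dem_conj_involution[OF inv] y(3) by simp
  next
    assume "z \<in> involutions \<and> atom_pattern (apply (w * ?s)) (apply z)"
    then have inv: "z \<in> involutions" and pat: "atom_pattern (apply (w * ?s)) (apply z)" by auto
    have zz: "z \<langle>$\<rangle> (z \<langle>$\<rangle> x) = x" for x using inv by (simp add: involutions_apply)
    have w_desc: "(w * ?s) \<langle>$\<rangle> (k + 1) < (w * ?s) \<langle>$\<rangle> k"
      using ascent.hyps by (simp add: apply_mult_simple_refl)
    have z_desc: "z \<langle>$\<rangle> (k + 1) < z \<langle>$\<rangle> k"
      by (rule atom_pattern_descent[OF pat zz w_desc])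
    have w: "apply w = apply (w * ?s * ?s)" by simp
    have "\<exists>y. w \<in> atoms y \<and> ascent y k \<and> z = dem_conj k y"
    proof (cases "z \<langle>$\<rangle> k = k + 1")
      case True
      then have True': "z \<langle>$\<rangle> (k + 1) = k" using zz by metis
      let ?y = "z * ?s"
      have z_swap: "z \<langle>$\<rangle> x = k + 1 \<longleftrightarrow> x = k" "z \<langle>$\<rangle> x = k \<longleftrightarrow> x = k + 1" for x
        using True True' zz by metis+
      have y: "?y \<in> involutions" "ascent ?y k"
        using z_desc zz z_swap by (auto simp: involutions_apply apply_mult_simple_refl)
      moreover have "atom_pattern (apply w) (apply ?y)"
        unfolding w apply_mult_simple_refl_fun[of "w * ?s"] apply_mult_simple_refl_fun[of z]
        by (rule atom_pattern_toggle_cycle[OF zz pat]) (use True in simp)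
      moreover have "z = dem_conj k ?y"
        unfolding dem_conj_ascent[OF y] using True True' by (simp add: apply_mult_simple_refl)
      ultimately show ?thesis using ascent.IH by blast
    next
      case False
      let ?y = "?s * z * ?s"
      have y: "?y \<in> involutions"
        using zz by (simp add: involutions_apply apply_times simple_refl_twice)
      have False': "z \<langle>$\<rangle> (k + 1) \<noteq> k" using False zz by metis
      have asc: "ascent ?y k"
        using z_desc False False' by (auto simp: apply_times apply_simple_refl)
      have "atom_pattern (apply w) (apply ?y)"
        unfolding w apply_mult_simple_refl_fun[of "w * ?s"] apply_conj_simple_refl_fun
        by (rule atom_pattern_conj[OF zz inj pat]) (use False w_desc z_desc in auto)
      moreover have "z = dem_conj k ?y"
        unfolding dem_conj_ascent[OF y asc] using z_desc
        by (auto simp: apply_times apply_simple_refl simp flip: mult.assoc)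
      ultimately show ?thesis using ascent.IH y asc by blast
    qed
    then show "w * ?s \<in> atoms z" using atoms_ascent_iff[OF ascent.hyps] by blast
  qed
qed

section \<open>Covers\<close>

lemma bruhat_less_swap: "i < j \<Longrightarrow> w \<langle>$\<rangle> i < w \<langle>$\<rangle> j \<Longrightarrow> bruhat_less w (w * \<langle>i \<leftrightarrow> j\<rangle>)"
  using bruhat_compatible_bruhat_less inv_count_swap_less[of i j w]
  unfolding bruhat_compatible_def is_transposition_def by (metis order_less_irrefl)

lemma bruhat_less_trans: "bruhat_less u v \<Longrightarrow> bruhat_less v w \<Longrightarrow> bruhat_less u w"
  using bruhat_compatible_bruhat_less unfolding bruhat_compatible_def by (blast dest: transpD)

lemma bruhat_less_inv_count: "bruhat_less u v \<Longrightarrow> inv_count u < inv_count v"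
  by (rule bruhat_less_least[OF bruhat_compatible_inv_count])

definition swap_cover :: "(int \<Rightarrow> int) \<Rightarrow> int \<Rightarrow> int \<Rightarrow> bool" where
  "swap_cover w i j \<longleftrightarrow> i < j \<and> w i < w j \<and> (\<forall>e. i < e \<longrightarrow> e < j \<longrightarrow> \<not> (w i < w e \<and> w e < w j))"

text \<open>
  A value at \<open>e\<close> strictly between would allow the chain
  \<open>w < w (i, e) < w (i, e) (e, j) < w (i, e) (e, j) (i, e) = w (i, j)\<close>.
\<close>
lemma bruhat_covers_swap_cover:
  assumes "i < j" and cover: "bruhat_covers w (w * \<langle>i \<leftrightarrow> j\<rangle>)"
  shows "swap_cover (apply w) i j"
proof -
  have interval: "{w} = {\<sigma>. bruhat_le w \<sigma> \<and> bruhat_less \<sigma> (w * \<langle>i \<leftrightarrow> j\<rangle>)}"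
    using cover by (simp add: bruhat_covers_def)
  then have less: "bruhat_less w (w * \<langle>i \<leftrightarrow> j\<rangle>)" by blast
  have between: "\<sigma> = w" if "bruhat_less w \<sigma>" "bruhat_less \<sigma> (w * \<langle>i \<leftrightarrow> j\<rangle>)" for \<sigma>
    using that interval by (auto simp: bruhat_le_def)
  have ij: "w \<langle>$\<rangle> i < w \<langle>$\<rangle> j"
    using bruhat_less_inv_count[OF less] inv_count_swap_less_iff[OF assms(1)] by blast
  have False if e: "i < e" "e < j" "w \<langle>$\<rangle> i < w \<langle>$\<rangle> e" "w \<langle>$\<rangle> e < w \<langle>$\<rangle> j" for e
  proof -
    let ?u = "w * \<langle>i \<leftrightarrow> e\<rangle>" and ?v = "w * \<langle>i \<leftrightarrow> e\<rangle> * \<langle>e \<leftrightarrow> j\<rangle>"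
    have wu: "bruhat_less w ?u" using e by (intro bruhat_less_swap) auto
    have uv: "bruhat_less ?u ?v" using e ij by (intro bruhat_less_swap) (auto simp: apply_times)
    have "bruhat_less ?v (?v * \<langle>i \<leftrightarrow> e\<rangle>)"
      using e ij by (intro bruhat_less_swap) (auto simp: apply_times)
    moreover have "?v * \<langle>i \<leftrightarrow> e\<rangle> = w * \<langle>i \<leftrightarrow> j\<rangle>"
      using e by (intro perm_eqI) (auto simp: apply_times apply_swap_if)
    ultimately have "?u = w"
      using between[OF wu] bruhat_less_trans[OF uv] by metis
    then show False using bruhat_less_inv_count[OF wu] by simp
  qed
  then show ?thesis using assms(1) ij by (auto simp: swap_cover_def)
qed

section \<open>The cases of \<open>\<tau>\<close> preserve the local conditions\<close>

text \<open>
  The condition that \<open>atom_pattern\<close> imposes on the cycles \<open>a \<le> b\<close> and \<open>c \<le> d\<close> if \<open>a < c\<close>, stated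
  for explicit points. It is free of quantifiers, so that a case distinction over finitely many cycles is a problem
  of linear arithmetic.
\<close>
definition pair_ok :: "(int \<Rightarrow> int) \<Rightarrow> int \<Rightarrow> int \<Rightarrow> int \<Rightarrow> int \<Rightarrow> bool" where
  "pair_ok w a b c d \<longleftrightarrow> a < c \<longrightarrow>
     (b < d \<longrightarrow> w a < w d) \<and>
     (d < b \<longrightarrow> \<not> (w b < w c \<and> w c < w a) \<and> \<not> (w b < w d \<and> w d < w a))"

lemma atom_pattern_pair_ok:
  assumes "atom_pattern w y" "a \<le> y a" "c \<le> y c"
  shows "pair_ok w a (y a) c (y c)"
  using atom_patternD(2)[OF assms(1), of a c] atom_patternD(2)[OF assms(1), of a "y c"]
    atom_patternD(3)[OF assms(1), of a c] assms(2,3)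
  by (auto simp: pair_ok_def)

lemma atom_patternI_pair_ok:
  assumes inv: "\<And>x. y (y x) = x" and inj: "inj w"
    and cyc: "\<And>x. x \<le> y x \<Longrightarrow> w (y x) \<le> w x"
    and pair: "\<And>x x'. x \<le> y x \<Longrightarrow> x' \<le> y x' \<Longrightarrow> pair_ok w x (y x) x' (y x')"
  shows "atom_pattern w y"
  unfolding atom_pattern_def
proof (intro conjI allI impI)
  fix x x' e
  define lo where "lo u = min u (y u)" for u
  have lo: "lo u \<le> y (lo u)" "u = lo u \<or> u = y (lo u)" "y u = lo u \<or> y u = y (lo u)"
    "lo u \<le> u" "lo u \<le> y u" "u \<le> y (lo u)" "y u \<le> y (lo u)" for u
    using inv by (auto simp: lo_def min_def)
  show "w (y x) < w x" if "x < y x"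
    using cyc[of x] injD[OF inj, of "y x" x] that by fastforce
  show "\<not> (w (y x) < w e \<and> w e < w x)" if "x < e" "e < y x"
    using that cyc[of x] cyc[of "lo e"] pair[of x "lo e"] pair[of "lo e" x] lo[of e] inv
    unfolding pair_ok_def by (smt (verit))
  show "w x < w (y x')" if "x < x'" "y x < y x'"
    using that cyc[of "lo x"] cyc[of "lo x'"] pair[of "lo x" "lo x'"] lo[of x] lo[of x'] inv
    unfolding pair_ok_def by (smt (verit))
qed

text \<open>
  The reduction of each case of \<open>\<tau>\<close> to arithmetic. The invariant set \<open>A\<close> contains the points whose
  values under \<open>w\<close> or images under \<open>y\<close> change, and \<open>C\<close> lists the new cycles on \<open>A\<close> as pairs
  \<open>p \<le> q\<close>. As the conditions concern two cycles at a time, it suffices to compare the new cycles with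
  each other and with one unchanged cycle \<open>e \<le> f\<close>, of which the comparison with the old cycles on \<open>A\<close>
  is known.
\<close>
lemma atom_pattern_modify:
  assumes pat: "atom_pattern w y" and inv: "\<And>x. y (y x) = x" and inj: "inj w"
    and ij: "i \<in> A" "j \<in> A"
    and outside: "\<And>x. x \<notin> A \<Longrightarrow> z x = y x"
    and cycles: "\<forall>x\<in>A. y x \<in> A \<and> ((x, z x) \<in> C \<or> (z x, x) \<in> C)"
      "\<forall>(p, q)\<in>C. p \<in> A \<and> q \<in> A \<and> z p = q \<and> z q = p \<and> p \<le> q"
  defines "W \<equiv> w \<circ> Transposition.transpose i j"
  assumes inside: "\<forall>(p, q)\<in>C. W q \<le> W p" "\<forall>(p, q)\<in>C. \<forall>(p', q')\<in>C. pair_ok W p q p' q'"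
    and mixed: "\<And>e f. e \<notin> A \<Longrightarrow> f \<notin> A \<Longrightarrow> e \<le> f \<Longrightarrow> w f \<le> w e \<Longrightarrow> W e = w e \<Longrightarrow> W f = w f \<Longrightarrow>
      \<forall>p\<in>A. w p \<noteq> w e \<and> w p \<noteq> w f \<Longrightarrow>
      \<forall>p\<in>A. p \<le> y p \<longrightarrow> pair_ok w p (y p) e f \<and> pair_ok w e f p (y p) \<Longrightarrow>
      \<forall>(p, q)\<in>C. pair_ok W p q e f \<and> pair_ok W e f p q"
  shows "atom_pattern W z \<and> (\<forall>x. z (z x) = x)"
proof -
  have W_out: "W x = w x" if "x \<notin> A" for x
    using that ij by (auto simp: W_def transpose_def)
  have y_out: "y x \<notin> A" if "x \<notin> A" for x using cycles(1) inv that by metis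
  have in_C: "(x, z x) \<in> C" if "x \<in> A" "x \<le> z x" for x
    using cycles that by force
  have mix: "pair_ok W p (z p) e (z e) \<and> pair_ok W e (z e) p (z p)"
    if "p \<in> A" "p \<le> z p" "e \<notin> A" "e \<le> z e" for p e
  proof -
    have e: "z e = y e" "y e \<notin> A" "e \<le> y e" using that outside y_out by auto
    have "w (y e) \<le> w e" using atom_pattern_cycle_le[OF pat e(3)] .
    moreover have "\<forall>p\<in>A. w p \<noteq> w e \<and> w p \<noteq> w (y e)" using inj that(3) e(2) by (auto simp: inj_eq)
    ultimately have "\<forall>(p, q)\<in>C. pair_ok W p q e (y e) \<and> pair_ok W e (y e) p q"
      using that(3) e W_out atom_pattern_pair_ok[OF pat _ e(3)] atom_pattern_pair_ok[OF pat e(3)]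
      by (intro mixed) auto
    then show ?thesis using in_C[OF that(1,2)] e(1) by auto
  qed
  have zz: "z (z x) = x" for x
    using cycles inv outside[of x] outside[of "y x"] y_out[of x] by (cases "x \<in> A") force+
  have "atom_pattern W z"
  proof (rule atom_patternI_pair_ok)
    show "z (z x) = x" for x by (rule zz)
    show "inj W" using inj by (simp add: W_def inj_compose)
    show "W (z x) \<le> W x" if "x \<le> z x" for x
      using that inside(1) in_C[of x] atom_pattern_cycle_le[OF pat, of x] y_out[of x] outside W_out
      by (cases "x \<in> A") auto
    fix x x' assume le: "x \<le> z x" "x' \<le> z x'"
    consider "x \<in> A" "x' \<in> A" | "x \<in> A" "x' \<notin> A" | "x \<notin> A" "x' \<in> A" | "x \<notin> A" "x' \<notin> A" by blast
    then show "pair_ok W x (z x) x' (z x')"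
    proof cases
      case 1 then show ?thesis using inside(2) in_C le by fastforce
    next
      case 4 then show ?thesis
        using atom_pattern_pair_ok[OF pat, of x x'] le outside W_out y_out by (simp add: pair_ok_def)
    qed (use mix le in auto)
  qed
  with zz show ?thesis by blast
qed

text \<open>
  The six cases of \<open>\<tau>\<close>. The conditions on the old cycles determine the order of the values \<open>w a\<close>, \<open>w b\<close>,
  \<open>\<dots>\<close> on the at most four points involved; the covering condition is needed at the two entries of the
  unchanged cycle, which otherwise could come to lie inside a new one.
\<close>
context
  fixes w y :: "int \<Rightarrow> int" and i j :: int
  assumes inj: "inj w" and inv: "\<And>x. y (y x) = x"
    and pat: "atom_pattern w y" and cov: "swap_cover w i j"
begin

abbreviation W :: "int \<Rightarrow> int" where
  "W \<equiv> w \<circ> Transposition.transpose i j"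

lemmas old_cycle = atom_pattern_cycle_le[OF pat]
  and old_pair = atom_pattern_pair_ok[OF pat]
  and cover = cov[unfolded swap_cover_def]
  and modify = atom_pattern_modify[OF pat inv inj]

lemma atom_pattern_tau1:
  assumes ord: "a < b"
    and ij: "i = a \<and> j = b"
    and y: "y a = a" "y b = b"
    and z: "z a = b" "z b = a" "\<And>x. x \<notin> {a, b} \<Longrightarrow> z x = y x"
  shows "atom_pattern W z \<and> (\<forall>x. z (z x) = x)"
proof (rule modify[where A = "{a, b}" and C = "{(a, b)}"])
  have W: "i = a \<and> j = b \<and> W a = w b \<and> W b = w a"
    using ij ord by (elim disjE conjE) (simp_all add: transpose_def)
  have old: "pair_ok w a a b b"
    using old_pair[of a b] y ord by simp_all
  have dist: "w a \<noteq> w b"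
    using inj_eq[OF inj] ord by simp_all
  show "i \<in> {a, b}" "j \<in> {a, b}" using ij by auto
  show "\<forall>x\<in>{a, b}. y x \<in> {a, b} \<and>
      ((x, z x) \<in> {(a, b)} \<or> (z x, x) \<in> {(a, b)})"
    by (simp add: y z)
  show "\<forall>(p, q)\<in>{(a, b)}.
      p \<in> {a, b} \<and> q \<in> {a, b} \<and> z p = q \<and> z q = p \<and> p \<le> q"
    using ord by (simp add: z)
  show "\<forall>(p, q)\<in>{(a, b)}. W q \<le> W p"
    "\<forall>(p, q)\<in>{(a, b)}. \<forall>(p', q')\<in>{(a, b)}. pair_ok W p q p' q'"
    using ord W cover old dist unfolding pair_ok_def ball_simps prod.case by (smt (verit))+
  fix e f
  assume e: "e \<notin> {a, b}" "f \<notin> {a, b}" "e \<le> f" "w f \<le> w e" "W e = w e" "W f = w f"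
    "\<forall>p\<in>{a, b}. w p \<noteq> w e \<and> w p \<noteq> w f"
    and "\<forall>p\<in>{a, b}. p \<le> y p \<longrightarrow> pair_ok w p (y p) e f \<and> pair_ok w e f p (y p)"
  then have pairs: "pair_ok w a a e f" "pair_ok w e f a a"
    "pair_ok w b b e f" "pair_ok w e f b b"
    using ord by (simp_all add: y)
  show "\<forall>(p, q)\<in>{(a, b)}. pair_ok W p q e f \<and> pair_ok W e f p q"
    using W pairs e ord cover old dist
    unfolding pair_ok_def ball_simps prod.case insert_iff empty_iff de_Morgan_disj
    by (smt (verit))
qed (rule z(3))

lemma atom_pattern_tau2:
  assumes ord: "a < b" "b < c"
    and ij: "i = b \<and> j = c \<or> i = a \<and> j = c"
    and y: "y a = b" "y b = a" "y c = c"
    and z: "z a = c" "z c = a" "z b = b" "\<And>x. x \<notin> {a, b, c} \<Longrightarrow> z x = y x"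
  shows "atom_pattern W z \<and> (\<forall>x. z (z x) = x)"
proof (rule modify[where A = "{a, b, c}" and C = "{(a, c), (b, b)}"])
  have W: "i = b \<and> j = c \<and> W a = w a \<and> W b = w c \<and> W c = w b \<or>
      i = a \<and> j = c \<and> W a = w c \<and> W b = w b \<and> W c = w a"
    using ij ord by (elim disjE conjE) (simp_all add: transpose_def)
  have old: "w b \<le> w a" "pair_ok w a b c c"
    using old_cycle[of a] old_pair[of a c] y ord by simp_all
  have dist: "w a \<noteq> w b" "w a \<noteq> w c" "w b \<noteq> w c"
    using inj_eq[OF inj] ord by simp_all
  show "i \<in> {a, b, c}" "j \<in> {a, b, c}" using ij by auto
  show "\<forall>x\<in>{a, b, c}. y x \<in> {a, b, c} \<and>
      ((x, z x) \<in> {(a, c), (b, b)} \<or> (z x, x) \<in> {(a, c), (b, b)})"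
    by (simp add: y z)
  show "\<forall>(p, q)\<in>{(a, c), (b, b)}.
      p \<in> {a, b, c} \<and> q \<in> {a, b, c} \<and> z p = q \<and> z q = p \<and> p \<le> q"
    using ord by (simp add: z)
  show "\<forall>(p, q)\<in>{(a, c), (b, b)}. W q \<le> W p"
    "\<forall>(p, q)\<in>{(a, c), (b, b)}. \<forall>(p', q')\<in>{(a, c), (b, b)}. pair_ok W p q p' q'"
    using ord W cover old dist unfolding pair_ok_def ball_simps prod.case by (smt (verit))+
  fix e f
  assume e: "e \<notin> {a, b, c}" "f \<notin> {a, b, c}" "e \<le> f" "w f \<le> w e" "W e = w e" "W f = w f"
    "\<forall>p\<in>{a, b, c}. w p \<noteq> w e \<and> w p \<noteq> w f"
    and "\<forall>p\<in>{a, b, c}. p \<le> y p \<longrightarrow> pair_ok w p (y p) e f \<and> pair_ok w e f p (y p)"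
  then have pairs: "pair_ok w a b e f" "pair_ok w e f a b"
    "pair_ok w c c e f" "pair_ok w e f c c"
    using ord by (simp_all add: y)
  show "\<forall>(p, q)\<in>{(a, c), (b, b)}. pair_ok W p q e f \<and> pair_ok W e f p q"
    using W pairs e ord cover old dist
    unfolding pair_ok_def ball_simps prod.case insert_iff empty_iff de_Morgan_disj
    by (smt (verit))
qed (rule z(4))

lemma atom_pattern_tau3:
  assumes ord: "a < b" "b < c"
    and ij: "i = a \<and> j = b \<or> i = a \<and> j = c"
    and y: "y b = c" "y c = b" "y a = a"
    and z: "z a = c" "z c = a" "z b = b" "\<And>x. x \<notin> {a, b, c} \<Longrightarrow> z x = y x"
  shows "atom_pattern W z \<and> (\<forall>x. z (z x) = x)"
proof (rule modify[where A = "{a, b, c}" and C = "{(a, c), (b, b)}"])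
  have W: "i = a \<and> j = b \<and> W a = w b \<and> W b = w a \<and> W c = w c \<or>
      i = a \<and> j = c \<and> W a = w c \<and> W b = w b \<and> W c = w a"
    using ij ord by (elim disjE conjE) (simp_all add: transpose_def)
  have old: "w c \<le> w b" "pair_ok w a a b c"
    using old_cycle[of b] old_pair[of a b] y ord by simp_all
  have dist: "w a \<noteq> w b" "w a \<noteq> w c" "w b \<noteq> w c"
    using inj_eq[OF inj] ord by simp_all
  show "i \<in> {a, b, c}" "j \<in> {a, b, c}" using ij by auto
  show "\<forall>x\<in>{a, b, c}. y x \<in> {a, b, c} \<and>
      ((x, z x) \<in> {(a, c), (b, b)} \<or> (z x, x) \<in> {(a, c), (b, b)})"
    by (simp add: y z)
  show "\<forall>(p, q)\<in>{(a, c), (b, b)}.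
      p \<in> {a, b, c} \<and> q \<in> {a, b, c} \<and> z p = q \<and> z q = p \<and> p \<le> q"
    using ord by (simp add: z)
  show "\<forall>(p, q)\<in>{(a, c), (b, b)}. W q \<le> W p"
    "\<forall>(p, q)\<in>{(a, c), (b, b)}. \<forall>(p', q')\<in>{(a, c), (b, b)}. pair_ok W p q p' q'"
    using ord W cover old dist unfolding pair_ok_def ball_simps prod.case by (smt (verit))+
  fix e f
  assume e: "e \<notin> {a, b, c}" "f \<notin> {a, b, c}" "e \<le> f" "w f \<le> w e" "W e = w e" "W f = w f"
    "\<forall>p\<in>{a, b, c}. w p \<noteq> w e \<and> w p \<noteq> w f"
    and "\<forall>p\<in>{a, b, c}. p \<le> y p \<longrightarrow> pair_ok w p (y p) e f \<and> pair_ok w e f p (y p)"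
  then have pairs: "pair_ok w a a e f" "pair_ok w e f a a"
    "pair_ok w b c e f" "pair_ok w e f b c"
    using ord by (simp_all add: y)
  show "\<forall>(p, q)\<in>{(a, c), (b, b)}. pair_ok W p q e f \<and> pair_ok W e f p q"
    using W pairs e ord cover old dist
    unfolding pair_ok_def ball_simps prod.case insert_iff empty_iff de_Morgan_disj
    by (smt (verit))
qed (rule z(4))

lemma atom_pattern_tau4:
  assumes ord: "a < b" "b < c" "c < d"
    and ij: "i = b \<and> j = c"
    and y: "y a = b" "y b = a" "y c = d" "y d = c"
    and z: "z a = c" "z c = a" "z b = d" "z d = b" "\<And>x. x \<notin> {a, b, c, d} \<Longrightarrow> z x = y x"
  shows "atom_pattern W z \<and> (\<forall>x. z (z x) = x)"
proof (rule modify[where A = "{a, b, c, d}" and C = "{(a, c), (b, d)}"])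
  have W: "i = b \<and> j = c \<and> W a = w a \<and> W b = w c \<and> W c = w b \<and> W d = w d"
    using ij ord by (elim disjE conjE) (simp_all add: transpose_def)
  have old: "w b \<le> w a" "w d \<le> w c" "pair_ok w a b c d"
    using old_cycle[of a] old_cycle[of c] old_pair[of a c] y ord by simp_all
  have dist: "w a \<noteq> w b" "w a \<noteq> w c" "w a \<noteq> w d" "w b \<noteq> w c"
    "w b \<noteq> w d" "w c \<noteq> w d"
    using inj_eq[OF inj] ord by simp_all
  show "i \<in> {a, b, c, d}" "j \<in> {a, b, c, d}" using ij by auto
  show "\<forall>x\<in>{a, b, c, d}. y x \<in> {a, b, c, d} \<and>
      ((x, z x) \<in> {(a, c), (b, d)} \<or> (z x, x) \<in> {(a, c), (b, d)})"
    by (simp add: y z)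
  show "\<forall>(p, q)\<in>{(a, c), (b, d)}.
      p \<in> {a, b, c, d} \<and> q \<in> {a, b, c, d} \<and> z p = q \<and> z q = p \<and> p \<le> q"
    using ord by (simp add: z)
  show "\<forall>(p, q)\<in>{(a, c), (b, d)}. W q \<le> W p"
    "\<forall>(p, q)\<in>{(a, c), (b, d)}. \<forall>(p', q')\<in>{(a, c), (b, d)}. pair_ok W p q p' q'"
    using ord W cover old dist unfolding pair_ok_def ball_simps prod.case by (smt (verit))+
  fix e f
  assume e: "e \<notin> {a, b, c, d}" "f \<notin> {a, b, c, d}" "e \<le> f" "w f \<le> w e" "W e = w e" "W f = w f"
    "\<forall>p\<in>{a, b, c, d}. w p \<noteq> w e \<and> w p \<noteq> w f"
    and "\<forall>p\<in>{a, b, c, d}. p \<le> y p \<longrightarrow> pair_ok w p (y p) e f \<and> pair_ok w e f p (y p)"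
  then have pairs: "pair_ok w a b e f" "pair_ok w e f a b"
    "pair_ok w c d e f" "pair_ok w e f c d"
    using ord by (simp_all add: y)
  show "\<forall>(p, q)\<in>{(a, c), (b, d)}. pair_ok W p q e f \<and> pair_ok W e f p q"
    using W pairs e ord cover old dist
    unfolding pair_ok_def ball_simps prod.case insert_iff empty_iff de_Morgan_disj
    by (smt (verit))
qed (rule z(5))

lemma atom_pattern_tau5:
  assumes ord: "a < b" "b < c" "c < d"
    and ij: "i = a \<and> j = c \<or> i = b \<and> j = d \<or> i = a \<and> j = d"
    and y: "y a = b" "y b = a" "y c = d" "y d = c"
    and z: "z a = d" "z d = a" "z b = b" "z c = c" "\<And>x. x \<notin> {a, b, c, d} \<Longrightarrow> z x = y x"
  shows "atom_pattern W z \<and> (\<forall>x. z (z x) = x)"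
proof (rule modify[where A = "{a, b, c, d}" and C = "{(a, d), (b, b), (c, c)}"])
  have W: "i = a \<and> j = c \<and> W a = w c \<and> W b = w b \<and> W c = w a \<and> W d = w d \<or>
      i = b \<and> j = d \<and> W a = w a \<and> W b = w d \<and> W c = w c \<and> W d = w b \<or>
      i = a \<and> j = d \<and> W a = w d \<and> W b = w b \<and> W c = w c \<and> W d = w a"
    using ij ord by (elim disjE conjE) (simp_all add: transpose_def)
  have old: "w b \<le> w a" "w d \<le> w c" "pair_ok w a b c d"
    using old_cycle[of a] old_cycle[of c] old_pair[of a c] y ord by simp_all
  have dist: "w a \<noteq> w b" "w a \<noteq> w c" "w a \<noteq> w d" "w b \<noteq> w c"
    "w b \<noteq> w d" "w c \<noteq> w d"
    using inj_eq[OF inj] ord by simp_all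
  show "i \<in> {a, b, c, d}" "j \<in> {a, b, c, d}" using ij by auto
  show "\<forall>x\<in>{a, b, c, d}. y x \<in> {a, b, c, d} \<and>
      ((x, z x) \<in> {(a, d), (b, b), (c, c)} \<or> (z x, x) \<in> {(a, d), (b, b), (c, c)})"
    by (simp add: y z)
  show "\<forall>(p, q)\<in>{(a, d), (b, b), (c, c)}.
      p \<in> {a, b, c, d} \<and> q \<in> {a, b, c, d} \<and> z p = q \<and> z q = p \<and> p \<le> q"
    using ord by (simp add: z)
  show "\<forall>(p, q)\<in>{(a, d), (b, b), (c, c)}. W q \<le> W p"
    "\<forall>(p, q)\<in>{(a, d), (b, b), (c, c)}. \<forall>(p', q')\<in>{(a, d), (b, b), (c, c)}. pair_ok W p q p' q'"
    using ord W cover old dist unfolding pair_ok_def ball_simps prod.case by (smt (verit))+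
  fix e f
  assume e: "e \<notin> {a, b, c, d}" "f \<notin> {a, b, c, d}" "e \<le> f" "w f \<le> w e" "W e = w e" "W f = w f"
    "\<forall>p\<in>{a, b, c, d}. w p \<noteq> w e \<and> w p \<noteq> w f"
    and "\<forall>p\<in>{a, b, c, d}. p \<le> y p \<longrightarrow> pair_ok w p (y p) e f \<and> pair_ok w e f p (y p)"
  then have pairs: "pair_ok w a b e f" "pair_ok w e f a b"
    "pair_ok w c d e f" "pair_ok w e f c d"
    using ord by (simp_all add: y)
  show "\<forall>(p, q)\<in>{(a, d), (b, b), (c, c)}. pair_ok W p q e f \<and> pair_ok W e f p q"
    using W pairs e ord cover old dist
    unfolding pair_ok_def ball_simps prod.case insert_iff empty_iff de_Morgan_disj
    by (smt (verit))
qed (rule z(5))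

lemma atom_pattern_tau6:
  assumes ord: "a < b" "b < c" "c < d"
    and ij: "i = a \<and> j = b \<or> i = c \<and> j = d \<or> i = a \<and> j = d"
    and y: "y a = c" "y c = a" "y b = d" "y d = b"
    and z: "z a = d" "z d = a" "z b = c" "z c = b" "\<And>x. x \<notin> {a, b, c, d} \<Longrightarrow> z x = y x"
  shows "atom_pattern W z \<and> (\<forall>x. z (z x) = x)"
proof (rule modify[where A = "{a, b, c, d}" and C = "{(a, d), (b, c)}"])
  have W: "i = a \<and> j = b \<and> W a = w b \<and> W b = w a \<and> W c = w c \<and> W d = w d \<or>
      i = c \<and> j = d \<and> W a = w a \<and> W b = w b \<and> W c = w d \<and> W d = w c \<or>
      i = a \<and> j = d \<and> W a = w d \<and> W b = w b \<and> W c = w c \<and> W d = w a"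
    using ij ord by (elim disjE conjE) (simp_all add: transpose_def)
  have old: "w c \<le> w a" "w d \<le> w b" "pair_ok w a c b d"
    using old_cycle[of a] old_cycle[of b] old_pair[of a b] y ord by simp_all
  have dist: "w a \<noteq> w b" "w a \<noteq> w c" "w a \<noteq> w d" "w b \<noteq> w c"
    "w b \<noteq> w d" "w c \<noteq> w d"
    using inj_eq[OF inj] ord by simp_all
  show "i \<in> {a, b, c, d}" "j \<in> {a, b, c, d}" using ij by auto
  show "\<forall>x\<in>{a, b, c, d}. y x \<in> {a, b, c, d} \<and>
      ((x, z x) \<in> {(a, d), (b, c)} \<or> (z x, x) \<in> {(a, d), (b, c)})"
    by (simp add: y z)
  show "\<forall>(p, q)\<in>{(a, d), (b, c)}.
      p \<in> {a, b, c, d} \<and> q \<in> {a, b, c, d} \<and> z p = q \<and> z q = p \<and> p \<le> q"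
    using ord by (simp add: z)
  show "\<forall>(p, q)\<in>{(a, d), (b, c)}. W q \<le> W p"
    "\<forall>(p, q)\<in>{(a, d), (b, c)}. \<forall>(p', q')\<in>{(a, d), (b, c)}. pair_ok W p q p' q'"
    using ord W cover old dist unfolding pair_ok_def ball_simps prod.case by (smt (verit))+
  fix e f
  assume e: "e \<notin> {a, b, c, d}" "f \<notin> {a, b, c, d}" "e \<le> f" "w f \<le> w e" "W e = w e" "W f = w f"
    "\<forall>p\<in>{a, b, c, d}. w p \<noteq> w e \<and> w p \<noteq> w f"
    and "\<forall>p\<in>{a, b, c, d}. p \<le> y p \<longrightarrow> pair_ok w p (y p) e f \<and> pair_ok w e f p (y p)"
  then have pairs: "pair_ok w a c e f" "pair_ok w e f a c"
    "pair_ok w b d e f" "pair_ok w e f b d"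
    using ord by (simp_all add: y)
  show "\<forall>(p, q)\<in>{(a, d), (b, c)}. pair_ok W p q e f \<and> pair_ok W e f p q"
    using W pairs e ord cover old dist
    unfolding pair_ok_def ball_simps prod.case insert_iff empty_iff de_Morgan_disj
    by (smt (verit))
qed (rule z(5))

end

lemma tau_relE:
  assumes "tau_rel i j y z"
  obtains
    (case1) a b where "a < b" "i = a \<and> j = b"
      "y \<langle>$\<rangle> a = a" "y \<langle>$\<rangle> b = b"
      "z \<langle>$\<rangle> a = b" "z \<langle>$\<rangle> b = a" "\<And>x. x \<notin> {a, b} \<Longrightarrow> z \<langle>$\<rangle> x = y \<langle>$\<rangle> x"
  | (case2) a b c where "a < b" "b < c" "i = b \<and> j = c \<or> i = a \<and> j = c"
      "y \<langle>$\<rangle> a = b" "y \<langle>$\<rangle> b = a" "y \<langle>$\<rangle> c = c"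
      "z \<langle>$\<rangle> a = c" "z \<langle>$\<rangle> c = a" "z \<langle>$\<rangle> b = b" "\<And>x. x \<notin> {a, b, c} \<Longrightarrow> z \<langle>$\<rangle> x = y \<langle>$\<rangle> x"
  | (case3) a b c where "a < b" "b < c" "i = a \<and> j = b \<or> i = a \<and> j = c"
      "y \<langle>$\<rangle> b = c" "y \<langle>$\<rangle> c = b" "y \<langle>$\<rangle> a = a"
      "z \<langle>$\<rangle> a = c" "z \<langle>$\<rangle> c = a" "z \<langle>$\<rangle> b = b" "\<And>x. x \<notin> {a, b, c} \<Longrightarrow> z \<langle>$\<rangle> x = y \<langle>$\<rangle> x"
  | (case4) a b c d where "a < b" "b < c" "c < d" "i = b \<and> j = c"
      "y \<langle>$\<rangle> a = b" "y \<langle>$\<rangle> b = a" "y \<langle>$\<rangle> c = d" "y \<langle>$\<rangle> d = c"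
      "z \<langle>$\<rangle> a = c" "z \<langle>$\<rangle> c = a" "z \<langle>$\<rangle> b = d" "z \<langle>$\<rangle> d = b" "\<And>x. x \<notin> {a, b, c, d} \<Longrightarrow> z \<langle>$\<rangle> x = y \<langle>$\<rangle> x"
  | (case5) a b c d where "a < b" "b < c" "c < d" "i = a \<and> j = c \<or> i = b \<and> j = d \<or> i = a \<and> j = d"
      "y \<langle>$\<rangle> a = b" "y \<langle>$\<rangle> b = a" "y \<langle>$\<rangle> c = d" "y \<langle>$\<rangle> d = c"
      "z \<langle>$\<rangle> a = d" "z \<langle>$\<rangle> d = a" "z \<langle>$\<rangle> b = b" "z \<langle>$\<rangle> c = c" "\<And>x. x \<notin> {a, b, c, d} \<Longrightarrow> z \<langle>$\<rangle> x = y \<langle>$\<rangle> x"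
  | (case6) a b c d where "a < b" "b < c" "c < d" "i = a \<and> j = b \<or> i = c \<and> j = d \<or> i = a \<and> j = d"
      "y \<langle>$\<rangle> a = c" "y \<langle>$\<rangle> c = a" "y \<langle>$\<rangle> b = d" "y \<langle>$\<rangle> d = b"
      "z \<langle>$\<rangle> a = d" "z \<langle>$\<rangle> d = a" "z \<langle>$\<rangle> b = c" "z \<langle>$\<rangle> c = b" "\<And>x. x \<notin> {a, b, c, d} \<Longrightarrow> z \<langle>$\<rangle> x = y \<langle>$\<rangle> x"
proof -
  let ?A = "{i, j, y \<langle>$\<rangle> i, y \<langle>$\<rangle> j}"
  obtain p where out: "agree_on (- ?A) z y" and rule: "tau_rule ?A y i j p" and on: "agree_on ?A z p"
    using assms by (auto simp: tau_rel_def Let_def)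
  from rule show thesis
  proof cases
    case (case1 a b)
    have "agree_on (- {a, b}) z y" "agree_on {a, b} z p"
      using out on unfolding \<open>?A = {a, b}\<close> by simp_all
    with case1 show thesis
      by (intro that(1)[of a b]) (auto simp: agree_on_def apply_times)
  next
    case (case2 a b c)
    have "agree_on (- {a, b, c}) z y" "agree_on {a, b, c} z p"
      using out on unfolding \<open>?A = {a, b, c}\<close> by simp_all
    with case2 show thesis
      by (intro that(2)[of a b c]) (auto simp: agree_on_def apply_times)
  next
    case (case3 a b c)
    have "agree_on (- {a, b, c}) z y" "agree_on {a, b, c} z p"
      using out on unfolding \<open>?A = {a, b, c}\<close> by simp_all
    with case3 show thesis
      by (intro that(3)[of a b c]) (auto simp: agree_on_def apply_times)
  next
    case (case4 a b c d)
    have "agree_on (- {a, b, c, d}) z y" "agree_on {a, b, c, d} z p"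
      using out on unfolding \<open>?A = {a, b, c, d}\<close> by simp_all
    with case4 show thesis
      by (intro that(4)[of a b c d]) (auto simp: agree_on_def apply_times)
  next
    case (case5 a b c d)
    have "agree_on (- {a, b, c, d}) z y" "agree_on {a, b, c, d} z p"
      using out on unfolding \<open>?A = {a, b, c, d}\<close> by simp_all
    with case5 show thesis
      by (intro that(5)[of a b c d]) (auto simp: agree_on_def apply_times)
  next
    case (case6 a b c d)
    have "agree_on (- {a, b, c, d}) z y" "agree_on {a, b, c, d} z p"
      using out on unfolding \<open>?A = {a, b, c, d}\<close> by simp_all
    with case6 show thesis
      by (intro that(6)[of a b c d]) (auto simp: agree_on_def apply_times)
  qed
qed

text \<open>
  If \<open>q\<close> is the restriction of \<open>y\<close> to \<open>A\<close>, then \<open>y q\<close> fixes \<open>A\<close> pointwise and agrees with \<open>y\<close> elsewhere,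
  so \<open>y q p\<close> is the required permutation.
\<close>
lemma tau_rel_existsI:
  assumes A: "A = {i, j, y \<langle>$\<rangle> i, y \<langle>$\<rangle> j}" and rule: "tau_rule A y i j p" and y: "agree_on A y q"
    and p: "affected p \<subseteq> A" and q: "affected q \<subseteq> A" "\<And>x. q \<langle>$\<rangle> (q \<langle>$\<rangle> x) = x"
  shows "\<exists>z. tau_rel i j y z"
proof
  have p_A: "p \<langle>$\<rangle> x \<in> A" "q \<langle>$\<rangle> x \<in> A" if "x \<in> A" for x
    using p q(1) that apply_affected[of p x] apply_affected[of q x] by (metis in_affected subsetD)+
  have "(y * q * p) \<langle>$\<rangle> x = p \<langle>$\<rangle> x" if "x \<in> A" for x
    using y p_A that q(2) by (auto simp: agree_on_def apply_times)
  moreover have "(y * q * p) \<langle>$\<rangle> x = y \<langle>$\<rangle> x" if "x \<notin> A" for x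
    using p q(1) that in_affected[of x p] in_affected[of x q] by (auto simp: apply_times)
  ultimately show "tau_rel i j y (y * q * p)"
    using rule unfolding tau_rel_def Let_def A[symmetric] by (auto simp: agree_on_def)
qed

lemma tau_rel_exists1:
  assumes "a < b" and "i = a \<and> j = b"
    and "y \<langle>$\<rangle> a = a" "y \<langle>$\<rangle> b = b"
  shows "\<exists>z. tau_rel i j y z"
proof (rule tau_rel_existsI)
  show "{a, b} = {i, j, y \<langle>$\<rangle> i, y \<langle>$\<rangle> j}" using assms by auto
  show y: "agree_on {a, b} y 1" using assms by (simp add: agree_on_def apply_times)
  show "tau_rule {a, b} y i j (\<langle>a \<leftrightarrow> b\<rangle>)"
    by (rule tau_rule.case1[OF refl _ y]) (use assms in auto)
  show "affected (\<langle>a \<leftrightarrow> b\<rangle>) \<subseteq> {a, b}" "affected 1 \<subseteq> {a, b}"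
    using assms by (auto simp: in_affected apply_times apply_swap_if split: if_splits)
  show "1 \<langle>$\<rangle> (1 \<langle>$\<rangle> x) = x" for x
    using assms by (auto simp: apply_times apply_swap_if)
qed

lemma tau_rel_exists2:
  assumes "a < b" "b < c" and "i = b \<and> j = c \<or> i = a \<and> j = c"
    and "y \<langle>$\<rangle> a = b" "y \<langle>$\<rangle> b = a" "y \<langle>$\<rangle> c = c"
  shows "\<exists>z. tau_rel i j y z"
proof (rule tau_rel_existsI)
  show "{a, b, c} = {i, j, y \<langle>$\<rangle> i, y \<langle>$\<rangle> j}" using assms by auto
  show y: "agree_on {a, b, c} y (\<langle>a \<leftrightarrow> b\<rangle>)" using assms by (simp add: agree_on_def apply_times)
  show "tau_rule {a, b, c} y i j (\<langle>a \<leftrightarrow> c\<rangle>)"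
    by (rule tau_rule.case2[OF refl _ _ y]) (use assms in auto)
  show "affected (\<langle>a \<leftrightarrow> c\<rangle>) \<subseteq> {a, b, c}" "affected (\<langle>a \<leftrightarrow> b\<rangle>) \<subseteq> {a, b, c}"
    using assms by (auto simp: in_affected apply_times apply_swap_if split: if_splits)
  show "(\<langle>a \<leftrightarrow> b\<rangle>) \<langle>$\<rangle> ((\<langle>a \<leftrightarrow> b\<rangle>) \<langle>$\<rangle> x) = x" for x
    using assms by (auto simp: apply_times apply_swap_if)
qed

lemma tau_rel_exists3:
  assumes "a < b" "b < c" and "i = a \<and> j = b \<or> i = a \<and> j = c"
    and "y \<langle>$\<rangle> b = c" "y \<langle>$\<rangle> c = b" "y \<langle>$\<rangle> a = a"
  shows "\<exists>z. tau_rel i j y z"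
proof (rule tau_rel_existsI)
  show "{a, b, c} = {i, j, y \<langle>$\<rangle> i, y \<langle>$\<rangle> j}" using assms by auto
  show y: "agree_on {a, b, c} y (\<langle>b \<leftrightarrow> c\<rangle>)" using assms by (simp add: agree_on_def apply_times)
  show "tau_rule {a, b, c} y i j (\<langle>a \<leftrightarrow> c\<rangle>)"
    by (rule tau_rule.case3[OF refl _ _ y]) (use assms in auto)
  show "affected (\<langle>a \<leftrightarrow> c\<rangle>) \<subseteq> {a, b, c}" "affected (\<langle>b \<leftrightarrow> c\<rangle>) \<subseteq> {a, b, c}"
    using assms by (auto simp: in_affected apply_times apply_swap_if split: if_splits)
  show "(\<langle>b \<leftrightarrow> c\<rangle>) \<langle>$\<rangle> ((\<langle>b \<leftrightarrow> c\<rangle>) \<langle>$\<rangle> x) = x" for x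
    using assms by (auto simp: apply_times apply_swap_if)
qed

lemma tau_rel_exists4:
  assumes "a < b" "b < c" "c < d" and "i = b \<and> j = c"
    and "y \<langle>$\<rangle> a = b" "y \<langle>$\<rangle> b = a" "y \<langle>$\<rangle> c = d" "y \<langle>$\<rangle> d = c"
  shows "\<exists>z. tau_rel i j y z"
proof (rule tau_rel_existsI)
  show "{a, b, c, d} = {i, j, y \<langle>$\<rangle> i, y \<langle>$\<rangle> j}" using assms by auto
  show y: "agree_on {a, b, c, d} y (\<langle>a \<leftrightarrow> b\<rangle> * \<langle>c \<leftrightarrow> d\<rangle>)" using assms by (simp add: agree_on_def apply_times)
  show "tau_rule {a, b, c, d} y i j (\<langle>a \<leftrightarrow> c\<rangle> * \<langle>b \<leftrightarrow> d\<rangle>)"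
    by (rule tau_rule.case4[OF refl _ _ _ y]) (use assms in auto)
  show "affected (\<langle>a \<leftrightarrow> c\<rangle> * \<langle>b \<leftrightarrow> d\<rangle>) \<subseteq> {a, b, c, d}" "affected (\<langle>a \<leftrightarrow> b\<rangle> * \<langle>c \<leftrightarrow> d\<rangle>) \<subseteq> {a, b, c, d}"
    using assms by (auto simp: in_affected apply_times apply_swap_if split: if_splits)
  show "(\<langle>a \<leftrightarrow> b\<rangle> * \<langle>c \<leftrightarrow> d\<rangle>) \<langle>$\<rangle> ((\<langle>a \<leftrightarrow> b\<rangle> * \<langle>c \<leftrightarrow> d\<rangle>) \<langle>$\<rangle> x) = x" for x
    using assms by (auto simp: apply_times apply_swap_if)
qed

lemma tau_rel_exists5:
  assumes "a < b" "b < c" "c < d" and "i = a \<and> j = c \<or> i = b \<and> j = d \<or> i = a \<and> j = d"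
    and "y \<langle>$\<rangle> a = b" "y \<langle>$\<rangle> b = a" "y \<langle>$\<rangle> c = d" "y \<langle>$\<rangle> d = c"
  shows "\<exists>z. tau_rel i j y z"
proof (rule tau_rel_existsI)
  show "{a, b, c, d} = {i, j, y \<langle>$\<rangle> i, y \<langle>$\<rangle> j}" using assms by auto
  show y: "agree_on {a, b, c, d} y (\<langle>a \<leftrightarrow> b\<rangle> * \<langle>c \<leftrightarrow> d\<rangle>)" using assms by (simp add: agree_on_def apply_times)
  show "tau_rule {a, b, c, d} y i j (\<langle>a \<leftrightarrow> d\<rangle>)"
    by (rule tau_rule.case5[OF refl _ _ _ y]) (use assms in auto)
  show "affected (\<langle>a \<leftrightarrow> d\<rangle>) \<subseteq> {a, b, c, d}" "affected (\<langle>a \<leftrightarrow> b\<rangle> * \<langle>c \<leftrightarrow> d\<rangle>) \<subseteq> {a, b, c, d}"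
    using assms by (auto simp: in_affected apply_times apply_swap_if split: if_splits)
  show "(\<langle>a \<leftrightarrow> b\<rangle> * \<langle>c \<leftrightarrow> d\<rangle>) \<langle>$\<rangle> ((\<langle>a \<leftrightarrow> b\<rangle> * \<langle>c \<leftrightarrow> d\<rangle>) \<langle>$\<rangle> x) = x" for x
    using assms by (auto simp: apply_times apply_swap_if)
qed

lemma tau_rel_exists6:
  assumes "a < b" "b < c" "c < d" and "i = a \<and> j = b \<or> i = c \<and> j = d \<or> i = a \<and> j = d"
    and "y \<langle>$\<rangle> a = c" "y \<langle>$\<rangle> c = a" "y \<langle>$\<rangle> b = d" "y \<langle>$\<rangle> d = b"
  shows "\<exists>z. tau_rel i j y z"
proof (rule tau_rel_existsI)
  show "{a, b, c, d} = {i, j, y \<langle>$\<rangle> i, y \<langle>$\<rangle> j}" using assms by auto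
  show y: "agree_on {a, b, c, d} y (\<langle>a \<leftrightarrow> c\<rangle> * \<langle>b \<leftrightarrow> d\<rangle>)" using assms by (simp add: agree_on_def apply_times)
  show "tau_rule {a, b, c, d} y i j (\<langle>a \<leftrightarrow> d\<rangle> * \<langle>b \<leftrightarrow> c\<rangle>)"
    by (rule tau_rule.case6[OF refl _ _ _ y]) (use assms in auto)
  show "affected (\<langle>a \<leftrightarrow> d\<rangle> * \<langle>b \<leftrightarrow> c\<rangle>) \<subseteq> {a, b, c, d}" "affected (\<langle>a \<leftrightarrow> c\<rangle> * \<langle>b \<leftrightarrow> d\<rangle>) \<subseteq> {a, b, c, d}"
    using assms by (auto simp: in_affected apply_times apply_swap_if split: if_splits)
  show "(\<langle>a \<leftrightarrow> c\<rangle> * \<langle>b \<leftrightarrow> d\<rangle>) \<langle>$\<rangle> ((\<langle>a \<leftrightarrow> c\<rangle> * \<langle>b \<leftrightarrow> d\<rangle>) \<langle>$\<rangle> x) = x" for x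
    using assms by (auto simp: apply_times apply_swap_if)
qed

text \<open>
  In particular \<open>z\<close> is determined by \<open>tau_rel i j y z\<close>, as a permutation is an atom of at most one
  involution.
\<close>
lemma swap_cover_tau_atoms:
  assumes w: "w \<in> atoms y" and cov: "swap_cover (apply w) i j" and tau: "tau_rel i j y z"
  shows "w * \<langle>i \<leftrightarrow> j\<rangle> \<in> atoms z"
proof -
  have pat: "atom_pattern (apply w) (apply y)" and inv: "\<And>x. y \<langle>$\<rangle> (y \<langle>$\<rangle> x) = x"
    using w by (auto simp: atoms_iff_pattern involutions_apply)
  have inj: "inj (apply w)" by (simp add: inj_def apply_inj)
  note facts = inj inv pat cov
  have "atom_pattern (apply w \<circ> Transposition.transpose i j) (apply z) \<and> (\<forall>x. z \<langle>$\<rangle> (z \<langle>$\<rangle> x) = x)"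
    using tau
  proof (cases rule: tau_relE)
    case case1 show ?thesis by (rule atom_pattern_tau1[OF facts]) (fact case1)+
  next
    case case2 show ?thesis by (rule atom_pattern_tau2[OF facts]) (fact case2)+
  next
    case case3 show ?thesis by (rule atom_pattern_tau3[OF facts]) (fact case3)+
  next
    case case4 show ?thesis by (rule atom_pattern_tau4[OF facts]) (fact case4)+
  next
    case case5 show ?thesis by (rule atom_pattern_tau5[OF facts]) (fact case5)+
  next
    case case6 show ?thesis by (rule atom_pattern_tau6[OF facts]) (fact case6)+
  qed
  moreover have "apply (w * \<langle>i \<leftrightarrow> j\<rangle>) = apply w \<circ> Transposition.transpose i j"
    by (simp add: apply_times swap.rep_eq)
  ultimately show ?thesis by (simp add: atoms_iff_pattern involutions_apply)
qed

section \<open>Nested cycles\<close>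

text \<open>
  The cycle of \<open>y\<close> through \<open>q\<close> lies strictly inside the interval spanned by the cycle through \<open>p\<close>; the two
  disjuncts are for \<open>p\<close> being the smaller and the larger entry of its cycle.
\<close>
definition nested :: "int perm \<Rightarrow> int \<Rightarrow> int \<Rightarrow> bool" where
  "nested y p q \<longleftrightarrow>
     (p < q \<and> p < y \<langle>$\<rangle> q \<and> q < y \<langle>$\<rangle> p \<and> y \<langle>$\<rangle> q < y \<langle>$\<rangle> p) \<or>
     (y \<langle>$\<rangle> p < q \<and> y \<langle>$\<rangle> p < y \<langle>$\<rangle> q \<and> q < p \<and> y \<langle>$\<rangle> q < p)"

text \<open>
  Two configurations that are not nested are also missing from the six cases: \<open>y i = j\<close>, and crossing
  cycles \<open>(a, c)\<close>, \<open>(b, d)\<close> with \<open>a < b < c < d\<close>, \<open>i = b\<close> and \<open>j = c\<close>. For an atom they contradict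
  \<open>w i < w j\<close>: the local conditions give \<open>w j < w i\<close> in the former and \<open>w c < w a < w d < w b\<close> in the latter.
\<close>
lemma tau_rel_or_nested:
  assumes w: "w \<in> atoms y" and ij: "i < j" "w \<langle>$\<rangle> i < w \<langle>$\<rangle> j"
    and not_nested: "\<not> nested y i j" "\<not> nested y j i"
  shows "\<exists>z. tau_rel i j y z"
proof -
  have pat: "atom_pattern (apply w) (apply y)" and inv: "\<And>x. y \<langle>$\<rangle> (y \<langle>$\<rangle> x) = x"
    using w by (auto simp: atoms_iff_pattern involutions_apply)
  note D = atom_patternD[OF pat]
  have ne: "y \<langle>$\<rangle> i \<noteq> j" using D(1)[of i] ij by auto
  have ne': "y \<langle>$\<rangle> j \<noteq> i" using ne inv by metis
  have yy: "y \<langle>$\<rangle> i \<noteq> y \<langle>$\<rangle> j" using ij by (simp add: apply_inj)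
  define u v where "u = y \<langle>$\<rangle> i" and "v = y \<langle>$\<rangle> j"
  have y: "y \<langle>$\<rangle> i = u" "y \<langle>$\<rangle> u = i" "y \<langle>$\<rangle> j = v" "y \<langle>$\<rangle> v = j"
    using inv by (auto simp: u_def v_def)
  have uv: "u \<noteq> j" "v \<noteq> i" "u \<noteq> v" using ne ne' yy by (auto simp: u_def v_def)
  have cross: False if "v < i" "i < j" "j < u"
    using D(1)[of v] D(1)[of i] D(3)[of v i] that y ij by simp
  note n = not_nested[unfolded nested_def y(1,3)]
  consider "u = i" "v = j" | "u \<noteq> i" "v = j" | "u = i" "v \<noteq> j" | "u \<noteq> i" "v \<noteq> j" by blast
  then show ?thesis
  proof cases
    case 1
    then show ?thesis using ij y by (intro tau_rel_exists1[of i j]) auto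
  next
    case 2
    then have "u < j" using n ij uv by linarith
    show ?thesis
    proof (cases "i < u")
      case True then show ?thesis
        using 2 ij y \<open>u < j\<close> by (intro tau_rel_exists2[of i u j]) auto
    next
      case False then show ?thesis
        using 2 ij y \<open>u < j\<close> by (intro tau_rel_exists2[of u i j]) auto
    qed
  next
    case 3
    then have "i < v" using n ij uv by linarith
    show ?thesis
    proof (cases "j < v")
      case True then show ?thesis
        using 3 ij y \<open>i < v\<close> by (intro tau_rel_exists3[of i j v]) auto
    next
      case False then show ?thesis
        using 3 ij y \<open>i < v\<close> by (intro tau_rel_exists3[of i v j]) auto
    qed
  next
    case 4
    \<comment> \<open>The orders of two disjoint 2-cycles that are neither nested nor excluded by \<open>cross\<close>.\<close>
    consider "u < i" "j < v" | "i < u" "u < j" "j < v" | "i < u" "j < u" "j < v"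
      | "u < i" "i < v" "v < j" | "u < i" "v < i" "u < v"
      | "i < u" "u < v" "v < j" | "i < u" "v < u" "i < v" "v < j" "u < j"
      using 4 n ij uv cross by (smt (verit))
    then show ?thesis
    proof cases
      case 1 then show ?thesis
        using ij y by (intro tau_rel_exists4[of u i j v]) auto
    next
      case 2 then show ?thesis
        using ij y by (intro tau_rel_exists5[of i u j v]) auto
    next
      case 3 then show ?thesis
        using ij y n uv by (intro tau_rel_exists6[of i j u v]) auto
    next
      case 4 then show ?thesis
        using ij y by (intro tau_rel_exists5[of u i v j]) auto
    next
      case 5 then show ?thesis
        using ij y by (intro tau_rel_exists6[of u v i j]) auto
    next
      case 6 then show ?thesis
        using ij y by (intro tau_rel_exists5[of i u v j]) auto
    next
      case 7 then show ?thesis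
        using ij y by (intro tau_rel_exists6[of i v u j]) auto
    qed
  qed
qed

lemma ex_descent_between:
  fixes f :: "int \<Rightarrow> int"
  assumes "p < q" "f q < f p"
  obtains k where "p \<le> k" "k < q" "f (k + 1) < f k"
proof -
  have "\<exists>k\<ge>p. k < q \<and> f (k + 1) < f k"
    using assms
  proof (induction q rule: int_gr_induct)
    case base
    then show ?case by (intro exI[of _ p]) auto
  next
    case (step q)
    show ?case
    proof (cases "f (q + 1) < f q")
      case True
      then show ?thesis using step(1) by (intro exI[of _ q]) simp
    next
      case False
      then have "f q < f p" using step(3) by simp
      from step(2)[OF this] show ?thesis by force
    qed
  qed
  then show thesis using that by blast
qed

text \<open>
  One of \<open>i < j\<close> belongs to the outer cycle, and its partner \<open>d\<close> lies beyond the other one, say \<open>j < d\<close>.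
  Then \<open>w d < w i\<close>, and \<open>w i\<close> is the value of \<open>w (i, j)\<close> at \<open>j\<close>, so \<open>w (i, j)\<close> has a descent in \<open>[j, d)\<close>.
  It is also one of \<open>w\<close>, whose value at \<open>j\<close> is larger still.
\<close>
lemma common_descent:
  assumes pat: "atom_pattern (apply w) (apply y)" and ij: "i < j" "w \<langle>$\<rangle> i < w \<langle>$\<rangle> j"
    and inv: "\<And>x. y \<langle>$\<rangle> (y \<langle>$\<rangle> x) = x" and nested: "nested y i j \<or> nested y j i"
  obtains k where "w \<langle>$\<rangle> (k + 1) < w \<langle>$\<rangle> k"
    "(w * \<langle>i \<leftrightarrow> j\<rangle>) \<langle>$\<rangle> (k + 1) < (w * \<langle>i \<leftrightarrow> j\<rangle>) \<langle>$\<rangle> k" "k + 1 \<le> i \<or> j \<le> k"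
proof -
  let ?v = "w * \<langle>i \<leftrightarrow> j\<rangle>"
  have "(j < y \<langle>$\<rangle> i) \<or> (y \<langle>$\<rangle> j < i)" using nested ij by (auto simp: nested_def)
  then show thesis
  proof
    assume d: "j < y \<langle>$\<rangle> i"
    then have "w \<langle>$\<rangle> (y \<langle>$\<rangle> i) < w \<langle>$\<rangle> i" using atom_patternD(1)[OF pat, of i] ij by simp
    then have "?v \<langle>$\<rangle> (y \<langle>$\<rangle> i) < ?v \<langle>$\<rangle> j" using d ij by (simp add: apply_mult_swap)
    then obtain k where k: "j \<le> k" "?v \<langle>$\<rangle> (k + 1) < ?v \<langle>$\<rangle> k"
      using ex_descent_between[OF d, of "apply ?v"] by blast
    then have "w \<langle>$\<rangle> (k + 1) < w \<langle>$\<rangle> k"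
      using ij by (cases "k = j") (auto simp: apply_mult_swap)
    with k show thesis using that by blast
  next
    assume d: "y \<langle>$\<rangle> j < i"
    then have "w \<langle>$\<rangle> j < w \<langle>$\<rangle> (y \<langle>$\<rangle> j)"
      using atom_patternD(1)[OF pat, of "y \<langle>$\<rangle> j"] ij inv by simp
    then have "?v \<langle>$\<rangle> i < ?v \<langle>$\<rangle> (y \<langle>$\<rangle> j)" using d ij by (simp add: apply_mult_swap)
    then obtain k where k: "k < i" "?v \<langle>$\<rangle> (k + 1) < ?v \<langle>$\<rangle> k"
      using ex_descent_between[OF d, of "apply ?v"] by blast
    then have "w \<langle>$\<rangle> (k + 1) < w \<langle>$\<rangle> k"
      using ij by (cases "k + 1 = i") (auto simp: apply_mult_swap)
    with k show thesis using that by fastforce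
  qed
qed

text \<open>
  The step from \<open>y\<close> to \<open>s\<^sub>k \<circ> y \<circ> s\<^sub>k\<close> makes the cycles through \<open>s i\<close> and \<open>s j\<close> nested only if \<open>k\<close> and
  \<open>k + 1\<close> are their two smaller or their two larger entries, where a fixed point counts as either. In
  these cases \<open>\<tau>\<close> has nested them already, so \<open>z (k + 1) < z k\<close>.
\<close>
lemma tau_rel_unnesting_descent:
  fixes k :: int
  defines "s \<equiv> \<lambda>x. simple_refl k \<langle>$\<rangle> x"
  assumes tau: "tau_rel (s i) (s j) y z" and y: "y \<in> involutions" "ascent y k"
    and nested: "nested (dem_conj k y) i j \<or> nested (dem_conj k y) j i"
  shows "\<not> ascent z k"
proof -
  have s: "s x = (if x = k then k + 1 else if x = k + 1 then k else x)" for x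
    by (simp add: s_def apply_simple_refl)
  have ss: "s (s x) = x" for x by (simp add: s)
  define i' j' where "i' = s i" and "j' = s j"
  have ij: "i = s i'" "j = s j'" by (simp_all add: i'_def j'_def ss)
  note tau = tau[folded i'_def j'_def]
  have conj: "y \<langle>$\<rangle> k = k \<and> y \<langle>$\<rangle> (k + 1) = k + 1 \<and> dem_conj k y \<langle>$\<rangle> (s x) = y \<langle>$\<rangle> x \<or>
      \<not> (y \<langle>$\<rangle> k = k \<and> y \<langle>$\<rangle> (k + 1) = k + 1) \<and> dem_conj k y \<langle>$\<rangle> (s x) = s (y \<langle>$\<rangle> x)" for x
    unfolding dem_conj_ascent[OF y] by (simp add: apply_times ss flip: s_def)
  note n = nested[unfolded nested_def ij] conj[of i'] conj[of j'] s[of i'] s[of j'] s[of "y \<langle>$\<rangle> i'"] s[of "y \<langle>$\<rangle> j'"]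
  show ?thesis using tau
  proof (cases rule: tau_relE)
    case case1 then show ?thesis using n by (smt (verit))
  next
    case case2 then show ?thesis using n by (smt (verit))
  next
    case case3 then show ?thesis using n by (smt (verit))
  next
    case case4 then show ?thesis using n by (smt (verit))
  next
    case case5 then show ?thesis using n by (smt (verit))
  next
    case case6 then show ?thesis using n by (smt (verit))
  qed
qed

text \<open>
  Cancel a common descent \<open>k\<close> from \<open>w\<close> and \<open>w (i, j)\<close>; this gives a shorter cover for the transposition of
  \<open>s i\<close> and \<open>s j\<close>. By induction the cycles of the smaller involution are not nested, so the involution \<open>z'\<close> of the
  shorter \<open>w (i, j)\<close> is given by \<open>\<tau>\<close>. It has descent \<open>k\<close>, although the step by \<open>s\<^sub>k\<close> should be strict on it.
\<close>
lemma nested_not_atom: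
  assumes "w \<in> atoms y" "swap_cover (apply w) i j" "w * \<langle>i \<leftrightarrow> j\<rangle> \<in> atoms z"
  shows "\<not> (nested y i j \<or> nested y j i)"
  using assms
proof (induction "inv_count w" arbitrary: w y i j z rule: less_induct)
  case (less w y i j z)
  show ?case
  proof
    assume nested: "nested y i j \<or> nested y j i"
    have ij: "i < j" "w \<langle>$\<rangle> i < w \<langle>$\<rangle> j" using less.prems(2) by (auto simp: swap_cover_def)
    have pat: "atom_pattern (apply w) (apply y)" and inv: "\<And>x. y \<langle>$\<rangle> (y \<langle>$\<rangle> x) = x"
      using less.prems(1) by (auto simp: atoms_iff_pattern involutions_apply)
    let ?v = "w * \<langle>i \<leftrightarrow> j\<rangle>"
    obtain k where k: "w \<langle>$\<rangle> (k + 1) < w \<langle>$\<rangle> k" "?v \<langle>$\<rangle> (k + 1) < ?v \<langle>$\<rangle> k" "k + 1 \<le> i \<or> j \<le> k"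
      by (rule common_descent[OF pat ij inv nested])
    define s where "s = (\<lambda>x. simple_refl k \<langle>$\<rangle> x)"
    have s: "s x = (if x = k then k + 1 else if x = k + 1 then k else x)" for x
      by (simp add: s_def apply_simple_refl)
    let ?w = "w * simple_refl k"
    have asc: "ascent ?w k" "ascent (?v * simple_refl k) k"
      using k by (auto simp: ascent_mult_simple_refl)
    obtain y' where y': "?w \<in> atoms y'" "ascent y' k" "y = dem_conj k y'"
      using atoms_ascent_iff[OF asc(1), of y] less.prems(1) by auto
    obtain z' where z': "?v * simple_refl k \<in> atoms z'" "ascent z' k"
      using atoms_ascent_iff[OF asc(2), of z] less.prems(3) by auto
    have v: "?v * simple_refl k = ?w * \<langle>s i \<leftrightarrow> s j\<rangle>"
      using ij by (intro perm_eqI) (auto simp: apply_times apply_simple_refl apply_swap_if s)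
    \<comment> \<open>If \<open>k = j\<close> or \<open>k + 1 = i\<close>, one new point enters the interval; the descent of \<open>?v\<close> at \<open>k\<close> excludes its value.\<close>
    have cov: "swap_cover (apply ?w) (s i) (s j)"
    proof -
      have "\<not> (w \<langle>$\<rangle> i < w \<langle>$\<rangle> (s e) \<and> w \<langle>$\<rangle> (s e) < w \<langle>$\<rangle> j)" if "s i < e" "e < s j" for e
        using less.prems(2) that k ij
        by (auto simp: swap_cover_def s apply_mult_swap split: if_splits)
      moreover have "s i < s j" using ij k(3) by (auto simp: s)
      ultimately show ?thesis
        using ij by (simp add: swap_cover_def apply_times s_def simple_refl_twice)
    qed
    have "inv_count ?w < inv_count w" using inv_count_ascent[OF asc(1)] by simp
    from less.hyps[OF this y'(1) cov] z'(1)
    have "\<not> (nested y' (s i) (s j) \<or> nested y' (s j) (s i))" by (simp add: v)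
    then obtain z'' where tau: "tau_rel (s i) (s j) y' z''"
      using tau_rel_or_nested[OF y'(1)] cov unfolding swap_cover_def by blast
    have "z'' = z'"
      using swap_cover_tau_atoms[OF y'(1) cov tau] z'(1) by (simp add: v atoms_unique)
    moreover have "\<not> ascent z'' k"
      using tau_rel_unnesting_descent[OF tau[unfolded s_def] atoms_involution[OF y'(1)] y'(2)]
        nested y'(3) by blast
    ultimately show False using z'(2) by simp
  qed
qed

section \<open>Covers of atoms\<close>

theorem theorem3p20:
  fixes y w :: "int perm" and i j :: int
  assumes "y \<in> involutions"
    and "w \<in> atoms y"
    and "i < j"
    and "bruhat_covers w (w * \<langle>i \<leftrightarrow> j\<rangle>)"
  shows "(\<forall>z\<in>involutions. w * \<langle>i \<leftrightarrow> j\<rangle> \<in> atoms z \<longrightarrow> z = tau i j y \<and> tau i j y \<noteq> y) \<and>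
         ((\<forall>z\<in>involutions. w * \<langle>i \<leftrightarrow> j\<rangle> \<notin> atoms z) \<longrightarrow> tau i j y = y)"
proof -
  let ?v = "w * \<langle>i \<leftrightarrow> j\<rangle>"
  have cov: "swap_cover (apply w) i j" by (rule bruhat_covers_swap_cover[OF assms(3,4)])
  then have ij: "w \<langle>$\<rangle> i < w \<langle>$\<rangle> j" by (simp add: swap_cover_def)
  note tau_atoms = swap_cover_tau_atoms[OF assms(2) cov]
  show ?thesis
  proof (intro conjI ballI impI)
    fix z assume z: "?v \<in> atoms z"
    obtain z' where z': "tau_rel i j y z'"
      using tau_rel_or_nested[OF assms(2,3) ij] nested_not_atom[OF assms(2) cov z] by blast
    have "z'' = z" if "tau_rel i j y z''" for z''
      using tau_atoms[OF that] z by (rule atoms_unique)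
    then show tau: "z = tau i j y"
      using z' unfolding tau_def by (metis the_equality)
    have "z \<noteq> y"
      using z assms(2) inv_count_swap_less[OF assms(3) ij] by (auto simp: atoms_iff_height)
    then show "tau i j y \<noteq> y" using tau by simp
  next
    assume "\<forall>z\<in>involutions. ?v \<notin> atoms z"
    then have "\<nexists>z. tau_rel i j y z" using tau_atoms atoms_involution by blast
    then show "tau i j y = y" by (simp add: tau_def)
  qed
qed

end
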